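(* Let $X=\{X_t,t\ge0;\mathbb P_x,x\in E\}$ be a strong Markov process on a (topological) state space $E$, and let $S=\{S_t;t\ge0\}$ be a subordinator independent of $X$ whose Lévy measure $\mu$ satisfies $\mu(0,\infty)=\infty$, with Laplace exponent $\phi$. Let $E_t:=\inf\{s>0:S_s>t\}$ and $X^*_t:=X_{E_t}$ for $t\ge0$. Let $D$ be an open subset of $E$, and let $\tau_D:=\inf\{t>0:X_t\notin D\}$ and $\tau_D^*:=\inf\{t>0:X_t^*\notin D\}$. Then for every measurable function $f\ge0$ on $D$ and every $x\in D$, $$\mathbb E_x\left[\int_0^{\tau_D^*}f(X_t^* )\,dt\right]=\phi'(0)\,\mathbb E_x\left[\int_0^{\tau_D}f(X_t)\,dt\right]=\phi'(0)\,G_Df(x).$$ In other words, $\nu_x^{*,D}=\phi'(0)\,\nu_x^D$ for every open set $D\subset E$ and every $x\in D$.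
   Context: A subordinator is a non-negative valued Lévy process $\{S_t;t\ge0\}$ with $S_0=0$. Its Laplace exponent $\phi$ is given by $\mathbb E[e^{-\lambda S_t}]=e^{-t\phi(\lambda)}$, $\lambda>0$; one has $\phi(\lambda)=\kappa\lambda+\int_0^\infty(1-e^{-\lambda x})\,\mu(dx)$ for a unique drift $\kappa\ge0$ and Lévy measure $\mu$ on $(0,\infty)$ with $\int_0^\infty(1\wedge x)\mu(dx)<\infty$. Here $\phi'(0)=\lim_{\lambda\to0+}\phi'(\lambda)=\mathbb E[S_1]\in(0,\infty]$; the value $\infty$ is allowed (identities are in $[0,\infty]$, with $\infty\cdot0=0$). $\mathbb E_x$ is expectation with respect to $\mathbb P_x$, under which $X$ starts from $x$. $G_Df(x):=\mathbb E_x\left[\int_0^{\tau_D}f(X_t)\,dt\right]$. The occupation measures are, for $x\in D$ and measurable $A\subset D$, $$\nu_x^D(A)=\mathbb E_x\left[\int_0^{\tau_D}1_A(X_s)\,ds\right],\qquad \nu_x^{*,D}(A)=\mathbb E_x\left[\int_0^{\tau_D^*}1_A(X_s^* )\,ds\right].$$ *)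

theory Defs
  imports "HOL-Probability.Probability"
begin

section \<open>Strong Markov processes\<close>

text \<open>Processes are functions \<open>real \<Rightarrow> 'w \<Rightarrow> 'a\<close>, of which only the times \<open>t \<ge> 0\<close> matter. Random times
  take values in \<open>[0,\<infinity>]\<close>, so filtrations are indexed by \<^typ>\<open>ennreal\<close>, the value at \<open>\<infinity>\<close> being
  the information carried by the whole path.\<close>

definition times_upto :: "ennreal \<Rightarrow> real set" where
  "times_upto t = {s. 0 \<le> s \<and> ennreal s \<le> t}"

text \<open>The \<open>\<sigma>\<close>-algebra \<open>\<sigma>(X\<^sub>s, s \<le> t)\<close>.\<close>

definition history ::
  "'w measure \<Rightarrow> (real \<Rightarrow> 'w \<Rightarrow> 'a::topological_space) \<Rightarrow> ennreal \<Rightarrow> 'w measure" where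
  "history N X t =
     vimage_algebra (space N) (\<lambda>\<omega>. \<lambda>s\<in>times_upto t. X s \<omega>) (\<Pi>\<^sub>M s\<in>times_upto t. borel)"

text \<open>The probability measure \<open>N\<close> on the \<open>N\<close>-completion of \<open>\<sigma>(X)\<close>.\<close>

definition completed_path_measure ::
  "'w measure \<Rightarrow> (real \<Rightarrow> 'w \<Rightarrow> 'a::topological_space) \<Rightarrow> 'w measure" where
  "completed_path_measure N X = completion (restr_to_subalg N (history N X \<infinity>))"

text \<open>The natural filtration of \<open>X\<close>, augmented by the \<open>N\<close>-null sets of \<open>\<sigma>(X)\<close>.\<close>

definition augmented_filtration ::
  "'w measure \<Rightarrow> (real \<Rightarrow> 'w \<Rightarrow> 'a::topological_space) \<Rightarrow> ennreal \<Rightarrow> 'w measure" where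
  "augmented_filtration N X t =
     sigma (space N) (sets (history N X t) \<union> null_sets (completed_path_measure N X))"

text \<open>A strong Markov process \<open>{X\<^sub>t, t \<ge> 0; \<P>\<^sub>x, x \<in> E}\<close>, the state space \<open>E\<close> being the topological
  space \<^typ>\<open>'a\<close> with its Borel sets. A process with finite lifetime is covered by adding a cemetery
  point to \<open>E\<close>. Progressive measurability makes \<open>X\<^sub>T\<close> a random variable for every stopping time \<open>T\<close> and,
  by the debut theorem (the filtration is augmented), exit times from Borel sets measurable for the
  completion.\<close>

locale strong_markov_process =
  fixes X :: "real \<Rightarrow> 'w \<Rightarrow> 'a::topological_space"
    and P :: "'a \<Rightarrow> 'w measure"
  assumes prob_space_P: "prob_space (P x)"
    and sets_P: "sets (P x) = sets (P y)"
    and X_measurable: "0 \<le> t \<Longrightarrow> X t \<in> P x \<rightarrow>\<^sub>M borel"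
    and progressively_measurable:
      "0 \<le> t \<Longrightarrow> (\<lambda>(\<omega>, s). X s \<omega>) \<in>
         augmented_filtration (P x) X (ennreal t) \<Otimes>\<^sub>M restrict_space borel {0..t} \<rightarrow>\<^sub>M borel"
    and transition_measurable:
      "0 \<le> t \<Longrightarrow> A \<in> sets borel \<Longrightarrow>
         (\<lambda>y. emeasure (P y) {\<omega> \<in> space (P y). X t \<omega> \<in> A}) \<in> borel_measurable borel"
    and start: "AE \<omega> in P x. X 0 \<omega> = x"
    and strong_markov:
      "stopping_time (augmented_filtration (P x) X) T \<Longrightarrow> 0 \<le> u \<Longrightarrow> A \<in> sets borel \<Longrightarrow>
         AE \<omega> in completed_path_measure (P x) X. T \<omega> < \<infinity> \<longrightarrow>
           nn_cond_exp (completed_path_measure (P x) X)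
             (filtration.pre_sigma (space (P x)) (augmented_filtration (P x) X) T)
             (\<lambda>\<omega>. indicator {\<omega>. T \<omega> < \<infinity> \<and> X (enn2real (T \<omega>) + u) \<omega> \<in> A} \<omega>) \<omega>
           = emeasure (P (X (enn2real (T \<omega>)) \<omega>))
               {\<omega>' \<in> space (P (X (enn2real (T \<omega>)) \<omega>)). X u \<omega>' \<in> A}"


section \<open>Subordinators\<close>

definition cadlag :: "(real \<Rightarrow> real) \<Rightarrow> bool" where
  "cadlag p \<longleftrightarrow> (\<forall>t\<ge>0. (p \<longlongrightarrow> p t) (at_right t)) \<and> (\<forall>t>0. \<exists>l. (p \<longlongrightarrow> l) (at_left t))"

text \<open>Stochastic continuity follows from right-continuity at \<open>0\<close> and stationarity.\<close>

locale levy_process = prob_space N for N :: "'w measure" +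
  fixes S :: "real \<Rightarrow> 'w \<Rightarrow> real"
  assumes S_measurable: "0 \<le> t \<Longrightarrow> S t \<in> borel_measurable N"
    and S_zero: "AE \<omega> in N. S 0 \<omega> = 0"
    and independent_increments:
      "\<And>r (n::nat). 0 \<le> r 0 \<Longrightarrow> (\<And>i. i < n \<Longrightarrow> r i \<le> r (Suc i)) \<Longrightarrow>
         indep_vars (\<lambda>_. borel) (\<lambda>i \<omega>. S (r (Suc i)) \<omega> - S (r i) \<omega>) {..<n}"
    and stationary_increments:
      "0 \<le> s \<Longrightarrow> 0 \<le> t \<Longrightarrow> distr N borel (\<lambda>\<omega>. S (s + t) \<omega> - S s \<omega>) = distr N borel (S t)"
    and cadlag_paths: "AE \<omega> in N. cadlag (\<lambda>t. S t \<omega>)"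

locale subordinator = levy_process +
  assumes nonnegative: "AE \<omega> in N. \<forall>t\<ge>0. 0 \<le> S t \<omega>"

definition is_laplace_exponent ::
  "'w measure \<Rightarrow> (real \<Rightarrow> 'w \<Rightarrow> real) \<Rightarrow> (real \<Rightarrow> real) \<Rightarrow> bool" where
  "is_laplace_exponent N S \<phi> \<longleftrightarrow>
     (\<forall>t\<ge>0. \<forall>q>0. (\<integral>\<omega>. exp (- q * S t \<omega>) \<partial>N) = exp (- t * \<phi> q))"

text \<open>\<open>\<kappa>\<close> is the drift and \<open>\<mu>\<close>, a measure on \<open>(0,\<infinity>)\<close>, is the Levy measure belonging to \<open>\<phi>\<close>; they are
  unique.\<close>

definition has_drift_levy_measure :: "(real \<Rightarrow> real) \<Rightarrow> real \<Rightarrow> real measure \<Rightarrow> bool" where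
  "has_drift_levy_measure \<phi> \<kappa> \<mu> \<longleftrightarrow>
     0 \<le> \<kappa> \<and>
     sets \<mu> = sets (restrict_space borel {0<..}) \<and>
     (\<integral>\<^sup>+x. ennreal (min 1 x) \<partial>\<mu>) < \<infinity> \<and>
     (\<forall>q>0. \<phi> q = \<kappa> * q + (\<integral>x. (1 - exp (- q * x)) \<partial>\<mu>))"

text \<open>\<open>\<phi>'(0) \<in> [0,\<infinity>]\<close>. For a Laplace exponent, \<open>\<phi>'\<close> is nonnegative and nonincreasing on \<open>(0,\<infinity>)\<close>, so
  that the limit exists.\<close>

definition deriv_zero :: "(real \<Rightarrow> real) \<Rightarrow> ennreal" where
  "deriv_zero \<phi> = Lim (at_right 0) (\<lambda>q. ennreal (deriv \<phi> q))"


section \<open>Time change, exit times, Green operator, occupation measure\<close>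

definition inverse_process :: "(real \<Rightarrow> 'w \<Rightarrow> real) \<Rightarrow> real \<Rightarrow> 'w \<Rightarrow> ennreal" where
  "inverse_process S t \<omega> = (INF s\<in>{s. 0 < s \<and> t < S s \<omega>}. ennreal s)"

text \<open>Where \<open>E\<^sub>t = \<infinity>\<close> (a null event if the Levy measure is infinite, as then \<open>S\<^sub>t\<close> tends to \<open>\<infinity>\<close>
  almost surely) the value is junk.\<close>

definition time_changed ::
  "(real \<Rightarrow> 'w \<Rightarrow> 'a) \<Rightarrow> (real \<Rightarrow> 'w \<Rightarrow> real) \<Rightarrow> real \<Rightarrow> 'w \<Rightarrow> 'a" where
  "time_changed X S t \<omega> = X (enn2real (inverse_process S t \<omega>)) \<omega>"

definition exit_time :: "(real \<Rightarrow> 'w \<Rightarrow> 'a) \<Rightarrow> 'a set \<Rightarrow> 'w \<Rightarrow> ennreal" where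
  "exit_time Y D \<omega> = (INF t\<in>{t. 0 < t \<and> Y t \<omega> \<notin> D}. ennreal t)"

text \<open>\<open>\<integral>\<^sub>0\<^bsup>\<tau>\<^esup> f(Y\<^sub>t) dt\<close> with \<open>\<tau>\<close> the exit time of \<open>Y\<close> from \<open>D\<close>. The integral is over \<open>(0,\<tau>)\<close>, where
  \<open>Y\<^sub>t\<close> lies in \<open>D\<close>: the values of \<open>f\<close> outside \<open>D\<close> are not used.\<close>

definition integral_until_exit ::
  "(real \<Rightarrow> 'w \<Rightarrow> 'a) \<Rightarrow> 'a set \<Rightarrow> ('a \<Rightarrow> ennreal) \<Rightarrow> 'w \<Rightarrow> ennreal" where
  "integral_until_exit Y D f \<omega> =
     (\<integral>\<^sup>+t\<in>{t. 0 < t \<and> ennreal t < exit_time Y D \<omega>}. f (Y t \<omega>) \<partial>lborel)"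

definition green_operator ::
  "(real \<Rightarrow> 'w \<Rightarrow> 'a) \<Rightarrow> ('a \<Rightarrow> 'w measure) \<Rightarrow> 'a set \<Rightarrow> ('a \<Rightarrow> ennreal) \<Rightarrow> 'a \<Rightarrow> ennreal" where
  "green_operator X P D f x = (\<integral>\<^sup>+\<omega>. integral_until_exit X D f \<omega> \<partial>P x)"

definition occupation_measure ::
  "(real \<Rightarrow> 'w \<Rightarrow> 'a) \<Rightarrow> ('a \<Rightarrow> 'w measure) \<Rightarrow> 'a set \<Rightarrow> 'a \<Rightarrow> 'a set \<Rightarrow> ennreal" where
  "occupation_measure Y P D x A = (\<integral>\<^sup>+\<omega>. integral_until_exit Y D (indicator A) \<omega> \<partial>P x)"

end

theory Submission
  imports Defs "HOL-Real_Asymp.Real_Asymp"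
begin

text \<open>
  Write \<open>\<E>\<close> for the expectation, \<open>E\<^sub>t\<close> for the inverse of the subordinator \<open>S\<close>, \<open>\<tau>\<close> for the exit time of \<open>X\<close> from \<open>D\<close> and
  \<open>g(\<omega>, s) = f(X\<^sub>s(\<omega>))\<close> for \<open>0 < s < \<tau>(\<omega>)\<close>, \<open>g(\<omega>, s) = 0\<close> otherwise.

  The analytic core is a statement about \<open>S\<close> alone: for every measurable \<open>h \<ge> 0\<close>,
  \<open>\<E> \<integral> h(E\<^sub>t) dt = \<phi>'(0) \<integral> h(s) ds\<close> (\<open>occupation_of_inverse\<close>). As \<open>\<phi>'(0)\<close> may be infinite, the measure
  on the left need not be \<open>\<sigma>\<close>-finite, so it is not determined by its values on intervals. Discounting by
  \<open>e\<^bsup>-qt\<^esup>\<close> makes it finite. Since \<open>E\<^sub>t > a\<close> exactly when \<open>t > S\<^sub>a\<close>, the discounted measure gives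
  \<open>(a,\<infinity>)\<close> the mass \<open>\<E> e\<^bsup>-q S\<^sub>a\<^esup> / q = e\<^bsup>-a \<phi>(q)\<^esup> / q\<close>; hence its density is
  \<open>(\<phi>(q)/q) e\<^bsup>-s \<phi>(q)\<^esup>\<close> (\<open>discounted_occupation\<close>). As \<open>q\<close> decreases to \<open>0\<close>, both sides increase,
  \<open>\<phi>(q)/q\<close> to \<open>\<phi>'(0)\<close> and the exponential to \<open>1\<close>, and monotone convergence gives the claim.

  Independence of \<open>X\<close> and \<open>S\<close> and Tonelli's theorem allow \<open>h = g(\<omega>, \<cdot>)\<close> (\<open>time_changed_occupation\<close>), so that
  \<open>\<E> \<integral> g(\<omega>, E\<^sub>t) dt = \<phi>'(0) \<E> \<integral> g(\<omega>, s) ds\<close>. The right side is \<open>\<phi>'(0) G\<^sub>D f(x)\<close>. The left side is the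
  integral of \<open>f(X\<^sup>*)\<close> up to \<open>\<tau>\<^sup>*\<close>: as \<open>S\<close> is strictly increasing, \<open>E\<close> attains every value \<open>s\<close> (at time
  \<open>S\<^sub>s\<close>), hence \<open>t < \<tau>\<^sup>*\<close> and \<open>E\<^sub>t < \<tau>\<close> can differ only for \<open>t = \<tau>\<^sup>*\<close> or \<open>E\<^sub>t = \<tau>\<close>. The set of times of the
  second kind is Lebesgue-null almost surely, by \<open>time_changed_occupation\<close> for the indicator of
  \<open>s = \<tau>(\<omega>)\<close> (\<open>AE_exit_time_not_jumped\<close>).

  Tonelli's theorem requires \<open>g\<close>, hence \<open>\<tau>\<close>, to be measurable. Paths of \<open>X\<close> need not be right-continuous, and
  \<open>{\<tau> < r}\<close> is the projection to \<open>\<Omega>\<close> of a measurable set of pairs \<open>(\<omega>, s)\<close>. Such projections are measurable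
  for a complete measure; this is \<open>measurable_projection\<close>, proved by Suslin schemes and the
  capacitability argument of Choquet.
\<close>

section \<open>Measurable projection along the time axis\<close>

text \<open>A Suslin scheme is usually indexed by finite sequences. Letting \<open>K n \<sigma>\<close> depend on the infinite sequence
  \<open>\<sigma>\<close> through its first \<open>n\<close> entries only makes the reindexings below substitutions in \<open>\<sigma>\<close>.\<close>

definition souslin_scheme :: "'z set set \<Rightarrow> (nat \<Rightarrow> (nat \<Rightarrow> nat) \<Rightarrow> 'z set) \<Rightarrow> bool" where
  "souslin_scheme \<K> K \<longleftrightarrow> (\<forall>n \<sigma>. K n \<sigma> \<in> \<K>) \<and> (\<forall>n \<sigma> \<tau>. (\<forall>i<n. \<sigma> i = \<tau> i) \<longrightarrow> K n \<sigma> = K n \<tau>)"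

definition souslin :: "'z set set \<Rightarrow> 'z set \<Rightarrow> bool" where
  "souslin \<K> A \<longleftrightarrow> (\<exists>K. souslin_scheme \<K> K \<and> A = {z. \<exists>\<sigma>. \<forall>n. z \<in> K n \<sigma>})"

lemma souslin_schemeD:
  assumes "souslin_scheme \<K> K"
  shows "K n \<sigma> \<in> \<K>" "(\<And>i. i < n \<Longrightarrow> \<sigma> i = \<tau> i) \<Longrightarrow> K n \<sigma> = K n \<tau>"
  using assms unfolding souslin_scheme_def by blast+

lemma souslin_base: "C \<in> \<K> \<Longrightarrow> souslin \<K> C"
  unfolding souslin_def souslin_scheme_def by (intro exI[of _ "\<lambda>_ _. C"]) auto

text \<open>The first entry of \<open>\<sigma>\<close> selects the set, the others are passed on to its scheme. Level \<open>0\<close> may not depend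
  on \<open>\<sigma>\<close> and is filled by a common superset.\<close>

lemma souslin_UN:
  assumes A: "\<And>m::nat. souslin \<K> (A m)" and Z: "Z \<in> \<K>" "\<And>m. A m \<subseteq> Z"
  shows "souslin \<K> (\<Union>m. A m)"
proof -
  from A obtain K where scheme: "\<And>m. souslin_scheme \<K> (K m)"
    and K: "\<And>m. A m = {z. \<exists>\<sigma>. \<forall>n. z \<in> K m n \<sigma>}"
    unfolding souslin_def by metis
  note K_mem = souslin_schemeD(1)[OF scheme] and K_cong = souslin_schemeD(2)[OF scheme]
  define L where "L n \<sigma> = (case n of 0 \<Rightarrow> Z | Suc k \<Rightarrow> K (\<sigma> 0) k (\<sigma> \<circ> Suc))"
    for n and \<sigma> :: "nat \<Rightarrow> nat"
  have "(\<Union>m. A m) = {z. \<exists>\<sigma>. \<forall>n. z \<in> L n \<sigma>}"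
  proof (intro set_eqI iffI; unfold mem_Collect_eq)
    fix z
    assume "z \<in> (\<Union>m. A m)"
    then obtain m \<sigma> where m: "\<And>n. z \<in> K m n \<sigma>" "z \<in> A m" using K by blast
    have "z \<in> L n (case_nat m \<sigma>)" for n
      using m Z(2)[of m] by (auto simp: L_def comp_def split: nat.split)
    then show "\<exists>\<sigma>. \<forall>n. z \<in> L n \<sigma>" by blast
  next
    fix z
    assume "\<exists>\<sigma>. \<forall>n. z \<in> L n \<sigma>"
    then obtain \<sigma> where "\<And>n. z \<in> L n \<sigma>" by blast
    from this[of "Suc _"] have "z \<in> A (\<sigma> 0)" unfolding K L_def by auto
    then show "z \<in> (\<Union>m. A m)" by blast
  qed
  moreover have "L n \<sigma> = L n \<tau>" if "\<forall>i<n. \<sigma> i = \<tau> i" for n \<sigma> \<tau>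
    using that K_cong[of "n - 1" "\<sigma> \<circ> Suc" "\<tau> \<circ> Suc"] by (cases n) (auto simp: L_def)
  moreover have "L n \<sigma> \<in> \<K>" for n \<sigma>
    using K_mem Z(1) by (cases n) (auto simp: L_def)
  ultimately show ?thesis unfolding souslin_def souslin_scheme_def by (intro exI[of _ L] conjI allI impI)
qed

lemma prod_encode_strict_mono: "k < n \<Longrightarrow> prod_encode (m, k) < prod_encode (m, n)"
proof (induction n)
  case (Suc n)
  have "prod_encode (m, n) < prod_encode (m, Suc n)" by (simp add: prod_encode_def)
  with Suc show ?case by (cases "k = n") auto
qed simp

text \<open>A sequence \<open>\<sigma>\<close> codes a sequence of sequences through the pairing function. Level \<open>n\<close> of the \<open>m\<close>-th
  scheme is put at the code of \<open>(m, n)\<close>; the entries that it uses have smaller codes.\<close>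

lemma souslin_INT:
  assumes A: "\<And>m::nat. souslin \<K> (A m)"
  shows "souslin \<K> (\<Inter>m. A m)"
proof -
  from A obtain K where scheme: "\<And>m. souslin_scheme \<K> (K m)"
    and K: "\<And>m. A m = {z. \<exists>\<sigma>. \<forall>n. z \<in> K m n \<sigma>}"
    unfolding souslin_def by metis
  note K_mem = souslin_schemeD(1)[OF scheme] and K_cong = souslin_schemeD(2)[OF scheme]
  define L where "L j \<sigma> = (case prod_decode j of (m, n) \<Rightarrow> K m n (\<lambda>k. \<sigma> (prod_encode (m, k))))"
    for j and \<sigma> :: "nat \<Rightarrow> nat"
  have "(\<Inter>m. A m) = {z. \<exists>\<sigma>. \<forall>n. z \<in> L n \<sigma>}"
  proof (intro set_eqI iffI; unfold mem_Collect_eq)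
    fix z
    assume "z \<in> (\<Inter>m. A m)"
    then have "\<forall>m. \<exists>\<sigma>. \<forall>n. z \<in> K m n \<sigma>" using K by blast
    then obtain s where s: "\<And>m n. z \<in> K m n (s m)" by metis
    have "z \<in> L n (\<lambda>j. case prod_decode j of (m, k) \<Rightarrow> s m k)" for n
      using s by (auto simp: L_def split: prod.split)
    then show "\<exists>\<sigma>. \<forall>n. z \<in> L n \<sigma>" by blast
  next
    fix z
    assume "\<exists>\<sigma>. \<forall>n. z \<in> L n \<sigma>"
    then obtain \<sigma> where \<sigma>: "\<And>n. z \<in> L n \<sigma>" by blast
    have "z \<in> K m n (\<lambda>k. \<sigma> (prod_encode (m, k)))" for m n
      using \<sigma>[of "prod_encode (m, n)"] by (simp add: L_def)
    then show "z \<in> (\<Inter>m. A m)" unfolding K by blast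
  qed
  moreover have "L j \<sigma> = L j \<tau>" if eq: "\<forall>i<j. \<sigma> i = \<tau> i" for j \<sigma> \<tau>
  proof -
    obtain m n where j: "j = prod_encode (m, n)" by (metis prod_decode_inverse surj_pair)
    show ?thesis unfolding L_def j prod_encode_inverse prod.case
      by (rule K_cong) (use eq j prod_encode_strict_mono in auto)
  qed
  moreover have "L n \<sigma> \<in> \<K>" for n \<sigma>
    using K_mem by (auto simp: L_def split: prod.split)
  ultimately show ?thesis unfolding souslin_def souslin_scheme_def by (intro exI[of _ L] conjI allI impI)
qed

definition measurable_closed_rectangles :: "'a measure \<Rightarrow> ('a \<times> real) set set" where
  "measurable_closed_rectangles M = {F \<times> C | F C. F \<in> sets M \<and> closed C}"

lemma souslin_Un:
  assumes "souslin \<K> A" "souslin \<K> B" "Z \<in> \<K>" "A \<subseteq> Z" "B \<subseteq> Z"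
  shows "souslin \<K> (A \<union> B)"
proof -
  have "souslin \<K> (\<Union>m::nat. if m = 0 then A else B)"
    by (rule souslin_UN[where Z = Z]) (use assms in auto)
  moreover have "(\<Union>m::nat. if m = 0 then A else B) = A \<union> B" by (auto split: if_splits)
  ultimately show ?thesis by simp
qed

text \<open>Suslin sets are not closed under complements, so the induction over the \<open>\<sigma>\<close>-algebra carries the
  complement along. The same device serves for the product \<open>\<sigma>\<close>-algebra below.\<close>

lemma souslin_rectangle:
  assumes a: "a \<in> sets M" and b: "b \<in> sets borel"
  shows "souslin (measurable_closed_rectangles M) (a \<times> b) \<and>
         souslin (measurable_closed_rectangles M) (a \<times> (- b))"
proof -
  let ?S = "souslin (measurable_closed_rectangles M)"
  have closed: "?S (a \<times> C)" if "closed C" for C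
    using that a by (intro souslin_base) (auto simp: measurable_closed_rectangles_def)
  have Z: "a \<times> UNIV \<in> measurable_closed_rectangles M"
    using a by (auto simp: measurable_closed_rectangles_def)
  have "b \<in> sigma_sets UNIV (range (\<lambda>r::real. {..r}))"
    using b by (simp add: borel_eq_atMost)
  then show ?thesis
  proof induction
    case (Basic b)
    then obtain r where b: "b = {..r}" by auto
    have "?S (\<Union>n::nat. a \<times> {r + 1 / Suc n ..})"
      by (rule souslin_UN[where Z = "a \<times> UNIV"]) (use closed Z in auto)
    moreover have "(\<Union>n::nat. a \<times> {r + 1 / Suc n ..}) = a \<times> (- b)"
    proof -
      have "(\<exists>n::nat. r + 1 / Suc n \<le> y) \<longleftrightarrow> r < y" for y
      proof
        assume "\<exists>n::nat. r + 1 / Suc n \<le> y"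
        then obtain n :: nat where "r + 1 / Suc n \<le> y" by blast
        moreover have "0 < 1 / real (Suc n)" by simp
        ultimately show "r < y" by linarith
      next
        assume "r < y"
        then have "0 < y - r" by simp
        then obtain n where "1 / Suc n < y - r" using nat_approx_posE by blast
        then show "\<exists>n::nat. r + 1 / Suc n \<le> y" by (intro exI[of _ n]) linarith
      qed
      then show ?thesis unfolding b set_eq_iff by (simp add: mem_Times_iff not_le)
    qed
    ultimately show ?case using closed[of b] by (simp add: b)
  next
    case Empty
    show ?case using closed[of "{}"] closed[of UNIV] by simp
  next
    case (Compl b)
    then show ?case by (simp add: Compl_eq_Diff_UNIV[symmetric])
  next
    case (Union b)
    have "?S (\<Union>n::nat. a \<times> b n)"
      by (rule souslin_UN[where Z = "a \<times> UNIV"]) (use Union Z in auto)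
    moreover have "?S (\<Inter>n::nat. a \<times> (- b n))"
      by (rule souslin_INT) (use Union in auto)
    moreover have "(\<Union>n::nat. a \<times> b n) = a \<times> (\<Union>n. b n)" "(\<Inter>n::nat. a \<times> (- b n)) = a \<times> (- (\<Union>n. b n))"
      by auto
    ultimately show ?case by simp
  qed
qed

lemma souslin_measurable:
  assumes "A \<in> sets (M \<Otimes>\<^sub>M (borel :: real measure))"
  shows "souslin (measurable_closed_rectangles M) A"
proof -
  let ?S = "souslin (measurable_closed_rectangles M)"
  let ?Z = "space M \<times> (UNIV :: real set)"
  have Z: "?Z \<in> measurable_closed_rectangles M"
    by (auto simp: measurable_closed_rectangles_def)
  have "A \<in> sigma_sets ?Z {a \<times> b | a b. a \<in> sets M \<and> b \<in> sets borel}"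
    using assms by (simp add: sets_pair_measure)
  then have "?S A \<and> ?S (?Z - A) \<and> A \<subseteq> ?Z"
  proof induction
    case (Basic A)
    then obtain a b where A: "A = a \<times> b" "a \<in> sets M" "b \<in> sets borel" by auto
    have "?S ((space M - a) \<times> UNIV \<union> a \<times> (- b))"
      by (rule souslin_Un[OF _ _ Z]) (use A souslin_rectangle[of _ M] sets.sets_into_space[of a M] in auto)
    moreover have "(space M - a) \<times> UNIV \<union> a \<times> (- b) = ?Z - A"
      using sets.sets_into_space[OF A(2)] by (auto simp: A)
    ultimately show ?case using souslin_rectangle[of a M b] A sets.sets_into_space[OF A(2)] by auto
  next
    case Empty
    show ?case using souslin_base[OF Z] souslin_rectangle[of "{}" M "{}"] by simp
  next
    case (Compl A)
    then show ?case by (auto simp: double_diff)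
  next
    case (Union A)
    have "?S (\<Union>n. A n)" by (rule souslin_UN[OF _ Z]) (use Union in auto)
    moreover have "?S (\<Inter>n. ?Z - A n)" by (rule souslin_INT) (use Union in auto)
    moreover have "(\<Inter>n. ?Z - A n) = ?Z - (\<Union>n. A n)" by auto
    ultimately show ?case using Union by auto
  qed
  then show ?thesis by simp
qed

lemma compact_bounded_sequences: "compact {\<sigma> :: nat \<Rightarrow> nat. \<forall>i. \<sigma> i \<le> b i}"
proof -
  have "compactin (product_topology (\<lambda>i. euclidean) UNIV) (\<Pi>\<^sub>E i\<in>UNIV. {..b i})"
    unfolding compactin_PiE by (auto intro: finite_imp_compact)
  moreover have "(\<Pi>\<^sub>E i\<in>UNIV. {..b i}) = {\<sigma>. \<forall>i. \<sigma> i \<le> b i}" by (auto simp: PiE_def)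
  ultimately show ?thesis by (simp add: euclidean_product_topology)
qed

text \<open>Koenig's lemma and compactness of \<open>[-R, R]\<close> in one step: bounded branches form a compact space, along a
  convergent subsequence each coordinate of the branch is eventually constant, and the sets \<open>C j \<sigma>\<close> are
  closed.\<close>

lemma compact_branch:
  fixes C :: "nat \<Rightarrow> (nat \<Rightarrow> nat) \<Rightarrow> real set"
  assumes closed: "\<And>j \<sigma>. closed (C j \<sigma>)"
    and cong: "\<And>j \<sigma> \<tau>. (\<And>i. i < j \<Longrightarrow> \<sigma> i = \<tau> i) \<Longrightarrow> C j \<sigma> = C j \<tau>"
    and approx: "\<And>k. \<exists>r \<sigma>. \<bar>r\<bar> \<le> R \<and> (\<forall>i. \<sigma> i \<le> b i) \<and> (\<forall>j\<le>k. r \<in> C j \<sigma>)"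
  shows "\<exists>r \<sigma>. \<bar>r\<bar> \<le> R \<and> (\<forall>j. r \<in> C j \<sigma>)"
proof -
  obtain r \<sigma> where r: "\<And>k. \<bar>r k\<bar> \<le> R" and \<sigma>: "\<And>k i. \<sigma> k i \<le> b i"
    and in_C: "\<And>k j. j \<le> k \<Longrightarrow> r k \<in> C j (\<sigma> k)"
    using approx by metis
  have "seq_compact ({-R..R} \<times> {\<sigma>. \<forall>i. \<sigma> i \<le> b i})"
    by (intro compact_imp_seq_compact compact_Times compact_Icc compact_bounded_sequences)
  moreover have "\<forall>k. (r k, \<sigma> k) \<in> {-R..R} \<times> {\<sigma>. \<forall>i. \<sigma> i \<le> b i}"
    using r \<sigma> by (auto simp: abs_le_iff) (metis minus_le_iff)
  ultimately obtain l h where l: "l \<in> {-R..R} \<times> {\<sigma>. \<forall>i. \<sigma> i \<le> b i}"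
    and h: "strict_mono h" and lim: "((\<lambda>k. (r k, \<sigma> k)) \<circ> h) \<longlonglongrightarrow> l"
    by (rule seq_compactE)
  have lim1: "(\<lambda>k. r (h k)) \<longlonglongrightarrow> fst l" and lim2: "(\<lambda>k. \<sigma> (h k)) \<longlonglongrightarrow> snd l"
    using tendsto_fst[OF lim] tendsto_snd[OF lim] by (simp_all add: comp_def)
  have coord: "eventually (\<lambda>k. \<sigma> (h k) i = snd l i) sequentially" for i
  proof -
    have "open ((\<lambda>\<tau> :: nat \<Rightarrow> nat. \<tau> i) -` {snd l i})"
      by (intro open_vimage continuous_on_product_coordinates) (rule discrete_topology_class.open_discrete)
    from topological_tendstoD[OF lim2 this] show ?thesis by simp
  qed
  have "fst l \<in> C j (snd l)" for j
  proof -
    have "eventually (\<lambda>k. \<forall>i<j. \<sigma> (h k) i = snd l i) sequentially"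
      using eventually_ball_finite[of "{..<j}" "\<lambda>k i. \<sigma> (h k) i = snd l i" sequentially] coord
      by (simp add: Ball_def)
    moreover have "eventually (\<lambda>k. j \<le> k) sequentially" by (rule eventually_ge_at_top)
    ultimately have "eventually (\<lambda>k. r (h k) \<in> C j (snd l)) sequentially"
    proof eventually_elim
      case (elim k)
      have "r (h k) \<in> C j (\<sigma> (h k))"
        using elim(2) strict_mono_imp_increasing[OF h, of k] by (intro in_C) linarith
      then show ?case using cong[of j "\<sigma> (h k)" "snd l"] elim(1) by simp
    qed
    from Lim_in_closed_set[OF closed this _ lim1] show ?thesis by simp
  qed
  then show ?thesis using l by (intro exI[of _ "fst l"] exI[of _ "snd l"]) (auto simp: abs_le_iff)
qed

text \<open>The union of countably many inner approximations and a measurable hull of outer measure differ by a null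
  set, and \<open>B\<close> lies between them.\<close>

lemma (in complete_measure) sets_inner_approximation:
  assumes fin: "emeasure M (space M) < \<infinity>" and B: "B \<subseteq> space M"
    and inner: "\<And>c. c < outer_measure_of M B \<Longrightarrow> \<exists>G\<in>sets M. G \<subseteq> B \<and> c \<le> emeasure M G"
  shows "B \<in> sets M"
proof -
  obtain E where E: "E \<in> sets M" "B \<subseteq> E" "outer_measure_of M B = emeasure M E"
    using outer_measure_of_attain[OF B] by blast
  define c where "c = (SUP G\<in>{G\<in>sets M. G \<subseteq> B}. emeasure M G)"
  have "{G\<in>sets M. G \<subseteq> B} \<noteq> {}" by auto
  then have "emeasure M ` {G\<in>sets M. G \<subseteq> B} \<noteq> {}" by blast
  from ennreal_Sup_countable_SUP[OF this] obtain f where f: "range f \<subseteq> emeasure M ` {G\<in>sets M. G \<subseteq> B}"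
    "c = (SUP i::nat. f i)" unfolding c_def by blast
  then have "\<forall>i. \<exists>G. G \<in> sets M \<and> G \<subseteq> B \<and> f i = emeasure M G" by blast
  then obtain G where G: "\<And>i. G i \<in> sets M" "\<And>i. G i \<subseteq> B" "\<And>i. f i = emeasure M (G i)" by metis
  have UG: "(\<Union>i. G i) \<in> sets M" "(\<Union>i. G i) \<subseteq> B" using G by auto
  have 1: "c \<le> emeasure M (\<Union>i. G i)"
    unfolding f(2) G(3) using G(1) by (intro SUP_least emeasure_mono) auto
  have 2: "emeasure M E \<le> c"
  proof (rule dense_le)
    fix y assume "y < emeasure M E"
    then obtain H where H: "H \<in> sets M" "H \<subseteq> B" "y \<le> emeasure M H" using inner[of y] E(3) by auto
    then have "emeasure M H \<le> c" unfolding c_def by (intro SUP_upper) auto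
    with H show "y \<le> c" by simp
  qed
  have 3: "emeasure M (\<Union>i. G i) \<le> emeasure M E"
    using UG E by (intro emeasure_mono) auto
  have 4: "emeasure M E < \<infinity>"
    using le_less_trans[OF emeasure_space[of M E] fin] .
  show ?thesis
    using complete_sets_sandwich[OF UG(1) E(1) UG(2) E(2) antisym[OF 3 order_trans[OF 2 1]] le_less_trans[OF 3 4]] .
qed

text \<open>Choquet's capacitability argument. Bounding the entries of \<open>\<sigma>\<close> one after the other by suitable \<open>b 0\<close>,
  \<open>b 1\<close>, \<open>\<dots>\<close> keeps the outer measure of the projection above \<open>c\<close>, because outer measures are
  continuous along increasing sequences. Once all entries are bounded, level \<open>k\<close> of the scheme involves
  finitely many rectangles, so that its projection \<open>G k\<close> is measurable, and by compactness the intersection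
  of the \<open>G k\<close> lies in the projection of \<open>A\<close>.\<close>

lemma (in complete_measure) projection_bounded:
  assumes fin: "emeasure M (space M) < \<infinity>"
    and A: "A \<in> sets (M \<Otimes>\<^sub>M (borel :: real measure))" and bound: "A \<subseteq> UNIV \<times> {-R..R}"
  shows "fst ` A \<in> sets M"
proof (rule sets_inner_approximation[OF fin])
  show "fst ` A \<subseteq> space M" using sets.sets_into_space[OF A] by (auto simp: space_pair_measure)
  fix c assume c: "c < outer_measure_of M (fst ` A)"
  obtain K where scheme: "souslin_scheme (measurable_closed_rectangles M) K"
    and A_eq: "A = {z. \<exists>\<sigma>. \<forall>n. z \<in> K n \<sigma>}"
    using souslin_measurable[OF A] unfolding souslin_def by blast
  note K_mem = souslin_schemeD(1)[OF scheme] and K_cong = souslin_schemeD(2)[OF scheme]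
  have "\<forall>n \<sigma>. \<exists>F C. K n \<sigma> = F \<times> C \<and> F \<in> sets M \<and> closed C"
    using K_mem unfolding measurable_closed_rectangles_def by blast
  then obtain F C where K: "\<And>n \<sigma>. K n \<sigma> = F n \<sigma> \<times> C n \<sigma>"
    and F: "\<And>n \<sigma>. F n \<sigma> \<in> sets M" and C: "\<And>n \<sigma>. closed (C n \<sigma>)"
    by metis
  define W where "W b k = fst ` {z. \<exists>\<sigma>. (\<forall>i<k. \<sigma> i \<le> b i) \<and> (\<forall>n. z \<in> K n \<sigma>)}" for b k
  have W_sub: "W b k \<subseteq> space M" for b k
  proof -
    have "W b k \<subseteq> fst ` A" unfolding W_def A_eq by (intro image_mono Collect_mono) blast
    then show ?thesis using sets.sets_into_space[OF A] by (force simp: space_pair_measure)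
  qed
  have W_cong: "W b k = W b' k" if "\<And>i. i < k \<Longrightarrow> b i = b' i" for b b' k
    unfolding W_def using that by (intro arg_cong[where f="image fst"] Collect_cong) auto
  \<comment> \<open>\<open>W b k\<close> depends on \<open>b\<close> below \<open>k\<close> only; the update at \<open>k\<close> brings the claim into the form
    that the choice principle needs.\<close>
  have "\<exists>b. \<forall>k. c < outer_measure_of M (W (b(k := b k)) (Suc k))"
  proof (rule dependent_wellorder_choice)
    fix r :: nat and f g :: "nat \<Rightarrow> nat" and k :: nat
    assume "\<And>y. y < k \<Longrightarrow> f y = g y"
    then have "W (f(k := r)) (Suc k) = W (g(k := r)) (Suc k)" by (intro W_cong) auto
    then show "(c < outer_measure_of M (W (f(k := r)) (Suc k))) = (c < outer_measure_of M (W (g(k := r)) (Suc k)))"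
      by simp
  next
    fix k :: nat and f :: "nat \<Rightarrow> nat"
    assume IH: "\<And>y. y < k \<Longrightarrow> c < outer_measure_of M (W (f(y := f y)) (Suc y))"
    have "c < outer_measure_of M (W f k)"
    proof (cases k)
      case 0
      then have "W f k = fst ` A" unfolding W_def A_eq by simp
      then show ?thesis using c by simp
    next
      case (Suc y)
      then show ?thesis using IH[of y] by simp
    qed
    also have "W f k = (\<Union>m. W (f(k := m)) (Suc k))"
    proof (intro equalityI subsetI)
      fix \<omega> assume "\<omega> \<in> W f k"
      then obtain z \<sigma> where z: "\<omega> = fst z" "\<forall>i<k. \<sigma> i \<le> f i" "\<forall>n. z \<in> K n \<sigma>"
        unfolding W_def by blast
      then have "\<forall>i<Suc k. \<sigma> i \<le> (f(k := \<sigma> k)) i" by (simp add: less_Suc_eq)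
      then have "\<omega> \<in> W (f(k := \<sigma> k)) (Suc k)" unfolding W_def using z by blast
      then show "\<omega> \<in> (\<Union>m. W (f(k := m)) (Suc k))" by blast
    next
      fix \<omega> assume "\<omega> \<in> (\<Union>m. W (f(k := m)) (Suc k))"
      then obtain m z \<sigma> where z: "\<omega> = fst z" "\<forall>i<Suc k. \<sigma> i \<le> (f(k := m)) i" "\<forall>n. z \<in> K n \<sigma>"
        unfolding W_def by blast
      then have "\<forall>i<k. \<sigma> i \<le> f i" by (metis fun_upd_other less_SucI nat_neq_iff)
      then show "\<omega> \<in> W f k" unfolding W_def using z by blast
    qed
    also have "outer_measure_of M \<dots> = (SUP m. outer_measure_of M (W (f(k := m)) (Suc k)))"
    proof (rule SUP_outer_measure_of_incseq[symmetric, OF W_sub])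
      show "incseq (\<lambda>m. W (f(k := m)) (Suc k))"
      proof (intro incseq_SucI subsetI)
        fix m \<omega> assume "\<omega> \<in> W (f(k := m)) (Suc k)"
        then obtain z \<sigma> where z: "\<omega> = fst z" "\<forall>i<Suc k. \<sigma> i \<le> (f(k := m)) i" "\<forall>n. z \<in> K n \<sigma>"
          unfolding W_def by blast
        then have "\<forall>i<Suc k. \<sigma> i \<le> (f(k := Suc m)) i" by (auto simp: le_SucI)
        then show "\<omega> \<in> W (f(k := Suc m)) (Suc k)" unfolding W_def using z by blast
      qed
    qed
    finally show "\<exists>r. c < outer_measure_of M (W (f(k := r)) (Suc k))"
      unfolding less_SUP_iff by blast
  qed
  then obtain b where b: "\<And>k. c < outer_measure_of M (W b (Suc k))" by auto
  define G where "G k = {\<omega>\<in>space M. \<exists>r \<sigma>. \<bar>r\<bar> \<le> R \<and> (\<forall>i. \<sigma> i \<le> b i) \<and> (\<forall>j\<le>k. (\<omega>, r) \<in> K j \<sigma>)}" for k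
  \<comment> \<open>Lists stand for branches that vanish eventually. Being countably many, they make \<open>G k\<close> a countable union.\<close>
  define trunc :: "nat list \<Rightarrow> nat \<Rightarrow> nat" where "trunc l i = (if i < length l then l ! i else 0)" for l i
  have cut: "\<exists>l. (\<forall>i. trunc l i \<le> b i) \<and> (\<forall>j\<le>k. K j (trunc l) = K j \<sigma>)"
    if "\<And>i. i < k \<Longrightarrow> \<sigma> i \<le> b i" for \<sigma> k
  proof (intro exI conjI allI impI)
    let ?l = "map \<sigma> [0..<k]"
    show "trunc ?l i \<le> b i" for i using that by (simp add: trunc_def)
    show "K j (trunc ?l) = K j \<sigma>" if "j \<le> k" for j
      by (rule K_cong) (use that in \<open>simp add: trunc_def\<close>)
  qed
  have G_eq: "G k = (\<Union>l\<in>{l. (\<forall>i. trunc l i \<le> b i) \<and> (\<exists>r. \<bar>r\<bar> \<le> R \<and> (\<forall>j\<le>k. r \<in> C j (trunc l)))}.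
      (\<Inter>j\<in>{..k}. F j (trunc l)))" (is "_ = ?U") for k
  proof (intro equalityI subsetI)
    fix \<omega> assume "\<omega> \<in> G k"
    then obtain r \<sigma> where r: "\<bar>r\<bar> \<le> R" "\<And>i. \<sigma> i \<le> b i" "\<And>j. j \<le> k \<Longrightarrow> (\<omega>, r) \<in> K j \<sigma>"
      unfolding G_def by blast
    from cut[of k \<sigma>] r obtain l where "\<And>i. trunc l i \<le> b i" "\<And>j. j \<le> k \<Longrightarrow> K j (trunc l) = K j \<sigma>"
      by auto
    then have "\<And>j. j \<le> k \<Longrightarrow> (\<omega>, r) \<in> F j (trunc l) \<times> C j (trunc l)"
      using r(3) K by metis
    with r \<open>\<And>i. trunc l i \<le> b i\<close> show "\<omega> \<in> ?U" by (auto intro!: exI[of _ l] exI[of _ r])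
  next
    fix \<omega> assume "\<omega> \<in> ?U"
    then obtain l r where l: "\<And>i. trunc l i \<le> b i" "\<bar>r\<bar> \<le> R" "\<And>j. j \<le> k \<Longrightarrow> r \<in> C j (trunc l)"
      "\<And>j. j \<le> k \<Longrightarrow> \<omega> \<in> F j (trunc l)" by auto
    moreover have "\<omega> \<in> space M" using l(4)[of 0] sets.sets_into_space[OF F] by auto
    ultimately show "\<omega> \<in> G k"
      unfolding G_def K by (intro CollectI conjI exI[of _ r] exI[of _ "trunc l"]) auto
  qed
  have G_sets: "G k \<in> sets M" for k
  proof -
    have "(\<Inter>j\<in>{..k}. F j (trunc l)) \<in> sets M" for l
      by (rule sets.finite_INT) (use F in auto)
    then show ?thesis unfolding G_eq by (intro sets.countable_UN'') auto
  qed
  have W_G: "W b (Suc k) \<subseteq> G k" for k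
  proof
    fix \<omega> assume "\<omega> \<in> W b (Suc k)"
    then obtain z \<sigma> where z: "\<omega> = fst z" "\<forall>i<Suc k. \<sigma> i \<le> b i" "\<forall>n. z \<in> K n \<sigma>"
      unfolding W_def by blast
    obtain r where r: "z = (\<omega>, r)" using z(1) by (cases z) simp
    have "z \<in> A" using z(3) unfolding A_eq by blast
    then have "\<bar>r\<bar> \<le> R" "\<omega> \<in> space M"
      using bound sets.sets_into_space[OF A] by (auto simp: space_pair_measure abs_le_iff r)
    moreover obtain l where "\<forall>i. trunc l i \<le> b i" "\<forall>j\<le>Suc k. K j (trunc l) = K j \<sigma>"
      using cut[of "Suc k" \<sigma>] z(2) by blast
    moreover have "\<forall>j\<le>k. (\<omega>, r) \<in> K j (trunc l)"
      using calculation(4) z(3) by (metis le_SucI r)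
    ultimately show "\<omega> \<in> G k" unfolding G_def by blast
  qed
  show "\<exists>G\<in>sets M. G \<subseteq> fst ` A \<and> c \<le> emeasure M G"
  proof (intro bexI conjI)
    show "(\<Inter>k. G k) \<in> sets M" using G_sets by auto
    have "c \<le> emeasure M (G k)" for k
      using b[of k] outer_measure_of_mono[OF W_G, of M k] G_sets by (simp add: less_imp_le less_le_trans)
    moreover have "emeasure M (\<Inter>k. G k) = (INF k. emeasure M (G k))"
    proof (rule INF_emeasure_decseq[symmetric])
      show "decseq G"
      proof (intro decseq_SucI subsetI)
        fix k \<omega> assume "\<omega> \<in> G (Suc k)"
        then obtain r \<sigma> where r: "\<omega> \<in> space M" "\<bar>r\<bar> \<le> R" "\<forall>i. \<sigma> i \<le> b i" "\<forall>j\<le>Suc k. (\<omega>, r) \<in> K j \<sigma>"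
          unfolding G_def by blast
        from r(4) have "\<forall>j\<le>k. (\<omega>, r) \<in> K j \<sigma>" by simp
        with r(1-3) show "\<omega> \<in> G k" unfolding G_def by blast
      qed
      show "emeasure M (G k) \<noteq> \<infinity>" for k
        using le_less_trans[OF emeasure_space[of M "G k"] fin] by simp
    qed (use G_sets in auto)
    ultimately show "c \<le> emeasure M (\<Inter>k. G k)" by (auto intro: INF_greatest)
    show "(\<Inter>k. G k) \<subseteq> fst ` A"
    proof
      fix \<omega> assume \<omega>: "\<omega> \<in> (\<Inter>k. G k)"
      define C' where "C' j \<sigma> = {r. (\<omega>, r) \<in> K j \<sigma>}" for j \<sigma>
      have "\<exists>r \<sigma>. \<bar>r\<bar> \<le> R \<and> (\<forall>j. r \<in> C' j \<sigma>)"
      proof (rule compact_branch[where b = b])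
        show "closed (C' j \<sigma>)" for j \<sigma>
        proof -
          have "C' j \<sigma> = (if \<omega> \<in> F j \<sigma> then C j \<sigma> else {})" unfolding C'_def K by simp
          then show ?thesis using C by simp
        qed
        show "C' j \<sigma> = C' j \<tau>" if "\<And>i. i < j \<Longrightarrow> \<sigma> i = \<tau> i" for j \<sigma> \<tau>
          using K_cong[OF that] unfolding C'_def by simp
        show "\<exists>r \<sigma>. \<bar>r\<bar> \<le> R \<and> (\<forall>i. \<sigma> i \<le> b i) \<and> (\<forall>j\<le>k. r \<in> C' j \<sigma>)" for k
          using \<omega>[THEN INT_D, of k] unfolding G_def C'_def mem_Collect_eq by blast
      qed
      then obtain r \<sigma> where "\<forall>j. (\<omega>, r) \<in> K j \<sigma>" unfolding C'_def mem_Collect_eq by blast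
      then have "(\<omega>, r) \<in> A" unfolding A_eq by blast
      then show "\<omega> \<in> fst ` A" by (rule image_eqI[rotated]) simp
    qed
  qed
qed

text \<open>Bounded time intervals supply the compactness; they exhaust the time axis.\<close>

theorem (in complete_measure) measurable_projection:
  assumes fin: "emeasure M (space M) < \<infinity>"
    and A: "A \<in> sets (M \<Otimes>\<^sub>M (borel :: real measure))"
  shows "fst ` A \<in> sets M"
proof -
  have "fst ` (A \<inter> space M \<times> {- real n..real n}) \<in> sets M" for n
  proof (rule projection_bounded[OF fin])
    show "A \<inter> space M \<times> {- real n..real n} \<in> sets (M \<Otimes>\<^sub>M borel)" using A by measurable
  qed auto
  then have "(\<Union>n. fst ` (A \<inter> space M \<times> {- real n..real n})) \<in> sets M" by auto
  moreover have "(\<Union>n. fst ` (A \<inter> space M \<times> {- real n..real n})) = fst ` A"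
  proof (intro equalityI subsetI)
    fix \<omega> assume "\<omega> \<in> fst ` A"
    then obtain r where r: "(\<omega>, r) \<in> A" by auto
    obtain n where "\<bar>r\<bar> \<le> real n" using real_arch_simple by blast
    then have "(\<omega>, r) \<in> A \<inter> space M \<times> {- real n..real n}"
      using r sets.sets_into_space[OF A] by (auto simp: space_pair_measure abs_le_iff)
    then have "\<omega> \<in> fst ` (A \<inter> space M \<times> {- real n..real n})" by (rule image_eqI[rotated]) simp
    then show "\<omega> \<in> (\<Union>n. fst ` (A \<inter> space M \<times> {- real n..real n}))" by blast
  qed auto
  ultimately show ?thesis by simp
qed

section \<open>Laplace exponents with infinite Levy measure\<close>

text \<open>The dominating function for differentiation of \<open>\<phi>\<close> under the integral.\<close>

lemma exp_difference_quotient_bound: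
  fixes x c y q :: real
  assumes "0 < x" "c \<le> y" "c \<le> q" "y \<noteq> q"
  shows "\<bar>(exp (- q * x) - exp (- y * x)) / (y - q)\<bar> \<le> x * exp (- c * x)"
proof -
  have *: "\<bar>(exp (- q * x) - exp (- y * x)) / (y - q)\<bar> \<le> x * exp (- c * x)"
    if "c \<le> q" "q < y" for q y
  proof -
    have "exp (- q * x) - exp (- y * x) = exp (- q * x) * (1 - exp (- (y - q) * x))"
      by (simp add: algebra_simps flip: exp_add)
    also have "\<dots> \<le> exp (- c * x) * ((y - q) * x)"
    proof (rule mult_mono)
      show "exp (- q * x) \<le> exp (- c * x)" using that \<open>0 < x\<close> by simp
      show "1 - exp (- (y - q) * x) \<le> (y - q) * x" using exp_ge_add_one_self[of "- (y - q) * x"] by (simp add: algebra_simps)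
    qed (use that \<open>0 < x\<close> in \<open>auto simp: mult_le_0_iff\<close>)
    finally have "(exp (- q * x) - exp (- y * x)) / (y - q) \<le> x * exp (- c * x)"
      using that by (simp add: divide_le_eq mult_ac)
    moreover have "0 \<le> (exp (- q * x) - exp (- y * x)) / (y - q)"
      using that \<open>0 < x\<close> by (intro divide_nonneg_pos) auto
    ultimately show ?thesis by (simp only: abs_of_nonneg)
  qed
  show ?thesis
  proof (cases "q < y")
    case True
    with * assms show ?thesis by blast
  next
    case False
    with *[of y q] assms show ?thesis
      by (metis (no_types, lifting) minus_diff_eq minus_divide_divide not_less_iff_gr_or_eq)
  qed
qed

text \<open>Slopes of chords from the origin of a concave function decrease.\<close>

lemma one_minus_exp_quotient_antimono:
  fixes x p q :: real
  assumes "0 \<le> x" "0 < p" "p \<le> q"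
  shows "(1 - exp (- q * x)) / q \<le> (1 - exp (- p * x)) / p"
proof -
  have "((p / q) *\<^sub>R (- q * x) + (1 - p / q) *\<^sub>R 0) = - p * x" using assms by simp
  moreover have "exp ((1 - p / q) *\<^sub>R 0 + (p / q) *\<^sub>R (- q * x)) \<le> (1 - p / q) * exp 0 + (p / q) * exp (- q * x)"
    by (rule convex_onD[OF exp_convex]) (use assms in auto)
  ultimately have "exp (- p * x) \<le> 1 - p / q + p / q * exp (- q * x)" by (simp add: add.commute)
  then have "p * ((1 - exp (- q * x)) / q) \<le> 1 - exp (- p * x)"
    by (simp add: diff_divide_distrib right_diff_distrib)
  then show ?thesis using assms(2) by (simp add: pos_le_divide_eq mult.commute)
qed

text \<open>Monotone convergence for sequences that increase almost everywhere only: with respect to a Levy measure,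
  monotonicity in \<open>q\<close> is known for arguments in \<open>(0,\<infinity>)\<close>.\<close>

lemma nn_integral_tendsto_mono_AE:
  assumes mono: "AE x in M. mono (\<lambda>n::nat. f n x)" and [measurable]: "\<And>n. f n \<in> borel_measurable M"
    and lim: "AE x in M. (\<lambda>n. f n x) \<longlonglongrightarrow> u x"
  shows "(\<lambda>n. \<integral>\<^sup>+x. f n x \<partial>M) \<longlonglongrightarrow> (\<integral>\<^sup>+x. u x \<partial>M)"
proof -
  have le: "AE x in M. f m x \<le> f n x" if "m \<le> n" for m n
    using mono by eventually_elim (use that in \<open>auto dest: monoD\<close>)
  have "(\<integral>\<^sup>+x. u x \<partial>M) = (\<integral>\<^sup>+x. (SUP n. f n x) \<partial>M)"
    using mono lim by (intro nn_integral_cong_AE, eventually_elim) (blast intro: LIMSEQ_unique LIMSEQ_SUP)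
  also have "\<dots> = (SUP n. \<integral>\<^sup>+x. f n x \<partial>M)"
    by (rule nn_integral_monotone_convergence_SUP_AE) (use le in auto)
  finally show ?thesis
    using LIMSEQ_SUP[of "\<lambda>n. \<integral>\<^sup>+x. f n x \<partial>M"] le by (simp add: incseq_def nn_integral_mono_AE)
qed

locale infinite_levy_exponent =
  fixes \<phi> :: "real \<Rightarrow> real" and \<kappa> :: real and \<mu> :: "real measure"
  assumes drift_levy_measure: "has_drift_levy_measure \<phi> \<kappa> \<mu>"
    and infinite: "emeasure \<mu> {0<..} = \<infinity>"
begin

lemma drift_nonneg: "0 \<le> \<kappa>"
  and sets_levy: "sets \<mu> = sets (restrict_space borel {0<..})"
  and min_finite: "(\<integral>\<^sup>+x. ennreal (min 1 x) \<partial>\<mu>) < \<infinity>"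
  and exponent_eq: "0 < q \<Longrightarrow> \<phi> q = \<kappa> * q + (\<integral>x. (1 - exp (- q * x)) \<partial>\<mu>)"
  using drift_levy_measure unfolding has_drift_levy_measure_def by auto

lemma space_levy: "space \<mu> = {0<..}"
  using sets_eq_imp_space_eq[OF sets_levy] by (simp add: space_restrict_space)

lemma measurable_levy [measurable (raw)]:
  fixes f :: "real \<Rightarrow> 'b::topological_space"
  shows "f \<in> borel_measurable borel \<Longrightarrow> f \<in> borel_measurable \<mu>"
  using measurable_restrict_space1[of f borel borel "{0<..}"] measurable_cong_sets[OF sets_levy refl] by blast

text \<open>The condition on a Levy measure is that \<open>min 1 x\<close> be integrable.\<close>

lemma integrable_levy:
  fixes f :: "real \<Rightarrow> real"
  assumes [measurable]: "f \<in> borel_measurable borel" and bound: "\<And>x. 0 < x \<Longrightarrow> \<bar>f x\<bar> \<le> C * min 1 x"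
  shows "integrable \<mu> f"
proof (rule Bochner_Integration.integrable_bound)
  have "integrable \<mu> (\<lambda>x. min 1 x)"
  proof (rule integrableI_nonneg)
    show "AE x in \<mu>. 0 \<le> min 1 x" by (rule AE_I2) (simp add: space_levy)
  qed (use min_finite in auto)
  then show "integrable \<mu> (\<lambda>x. C * min 1 x)" by simp
  show "AE x in \<mu>. norm (f x) \<le> norm (C * min 1 x)"
    by (rule AE_I2) (use bound in \<open>force simp: space_levy\<close>)
qed simp

lemma integrable_one_minus_exp:
  assumes "0 < q" shows "integrable \<mu> (\<lambda>x. 1 - exp (- q * x))"
proof (rule integrable_levy[where C = "max 1 q"])
  fix x :: real assume x: "0 < x"
  have "1 - exp (- q * x) \<le> q * x" using exp_ge_add_one_self[of "- q * x"] by simp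
  also have "q * x \<le> max 1 q * x" using x by simp
  finally have "1 - exp (- q * x) \<le> max 1 q * x" .
  moreover have "1 - exp (- q * x) \<le> max 1 q * 1" by (simp add: add_increasing le_max_iff_disj)
  moreover have "0 \<le> 1 - exp (- q * x)" using x assms by simp
  ultimately show "\<bar>1 - exp (- q * x)\<bar> \<le> max 1 q * min 1 x" by (simp add: min_def)
qed simp

lemma integrable_mult_exp:
  assumes "0 < q" shows "integrable \<mu> (\<lambda>x. x * exp (- q * x))"
proof (rule integrable_levy[where C = "max 1 (1 / q)"])
  fix x :: real assume x: "0 < x"
  have "0 \<le> q * x" using assms x by simp
  have "q * x \<le> exp (q * x)" using exp_ge_add_one_self[of "q * x"] by linarith
  then have "x * exp (- q * x) \<le> 1 / q" using assms by (simp add: exp_minus field_simps)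
  then have "x * exp (- q * x) \<le> max 1 (1 / q) * 1" by simp
  moreover have "x * exp (- q * x) \<le> x * 1" using x assms by (intro mult_left_mono) auto
  then have "x * exp (- q * x) \<le> max 1 (1 / q) * x"
    using mult_right_mono[OF max.cobounded1[of 1 "1 / q"] less_imp_le[OF x]] by linarith
  ultimately have "x * exp (- q * x) \<le> max 1 (1 / q) * min 1 x" unfolding min_def by (simp only: split: if_split) simp
  moreover have "0 \<le> x * exp (- q * x)" using x by simp
  ultimately show "\<bar>x * exp (- q * x)\<bar> \<le> max 1 (1 / q) * min 1 x" by (simp only: abs_of_nonneg)
qed simp

text \<open>The expectation of \<open>S\<^sub>1\<close>, expressed by drift and Levy measure. It is the common limit at \<open>0\<close> of
  the slopes \<open>\<phi>' q\<close> and \<open>\<phi> q / q\<close>.\<close>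

definition mean :: ennreal where "mean = ennreal \<kappa> + (\<integral>\<^sup>+x. ennreal x \<partial>\<mu>)"

lemma exponent_has_derivative:
  assumes q: "0 < q"
  shows "(\<phi> has_real_derivative \<kappa> + (\<integral>x. x * exp (- q * x) \<partial>\<mu>)) (at q)"
proof -
  \<comment> \<open>Staying above \<open>q / 2\<close> leaves the derivative at \<open>q\<close> unchanged and provides a dominating
    function that is independent of the approximating sequence.\<close>
  let ?U = "{q / 2 <..}"
  have "((\<lambda>y. (\<phi> y - \<phi> q) / (y - q)) \<longlongrightarrow> \<kappa> + (\<integral>x. x * exp (- q * x) \<partial>\<mu>)) (at q within ?U)"
    unfolding tendsto_at_iff_sequentially
  proof (intro allI impI)
    fix y :: "nat \<Rightarrow> real" assume y: "\<forall>i. y i \<in> ?U - {q}" and lim: "y \<longlonglongrightarrow> q"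
    have ypos: "0 < y i" for i using y q by (auto intro: less_trans[of 0 "q / 2"])
    have eq: "(\<phi> (y i) - \<phi> q) / (y i - q) = \<kappa> + (\<integral>x. (exp (- q * x) - exp (- y i * x)) / (y i - q) \<partial>\<mu>)" for i
    proof -
      have "(\<integral>x. (1 - exp (- y i * x)) \<partial>\<mu>) - (\<integral>x. (1 - exp (- q * x)) \<partial>\<mu>)
        = (\<integral>x. (1 - exp (- y i * x)) - (1 - exp (- q * x)) \<partial>\<mu>)"
        by (intro Bochner_Integration.integral_diff[symmetric] integrable_one_minus_exp q ypos)
      also have "\<dots> = (\<integral>x. exp (- q * x) - exp (- y i * x) \<partial>\<mu>)" by simp
      finally have "\<phi> (y i) - \<phi> q = \<kappa> * (y i - q) + (\<integral>x. exp (- q * x) - exp (- y i * x) \<partial>\<mu>)"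
        unfolding exponent_eq[OF q] exponent_eq[OF ypos] by (simp add: algebra_simps)
      moreover have "y i - q \<noteq> 0" using y by simp
      ultimately show ?thesis by (simp add: add_divide_distrib)
    qed
    have "(\<lambda>i. \<integral>x. (exp (- q * x) - exp (- y i * x)) / (y i - q) \<partial>\<mu>) \<longlonglongrightarrow> (\<integral>x. x * exp (- q * x) \<partial>\<mu>)"
    proof (rule integral_dominated_convergence[where w = "\<lambda>x. x * exp (- (q / 2) * x)"])
      show "integrable \<mu> (\<lambda>x. x * exp (- (q / 2) * x))" by (rule integrable_mult_exp) (use q in simp)
      show "AE x in \<mu>. norm ((exp (- q * x) - exp (- y i * x)) / (y i - q)) \<le> x * exp (- (q / 2) * x)" for i
      proof (rule AE_I2)
        fix x assume "x \<in> space \<mu>"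
        then show "norm ((exp (- q * x) - exp (- y i * x)) / (y i - q)) \<le> x * exp (- (q / 2) * x)"
          unfolding real_norm_def using y[rule_format, of i] q
          by (intro exp_difference_quotient_bound) (auto simp: space_levy)
      qed
      have "(\<lambda>i. (exp (- q * x) - exp (- y i * x)) / (y i - q)) \<longlonglongrightarrow> x * exp (- q * x)" for x
      proof -
        have "((\<lambda>u. - exp (- u * x)) has_real_derivative x * exp (- q * x)) (at q)"
          by (auto intro!: derivative_eq_intros)
        then have "((\<lambda>u. (- exp (- u * x) - - exp (- q * x)) / (u - q)) \<longlongrightarrow> x * exp (- q * x)) (at q)"
          unfolding has_field_derivative_iff .
        moreover have "filterlim y (at q) sequentially"
          unfolding filterlim_at using lim y by simp
        ultimately show ?thesis
          by (auto dest: filterlim_compose)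
      qed
      then show "AE x in \<mu>. (\<lambda>i. (exp (- q * x) - exp (- y i * x)) / (y i - q)) \<longlonglongrightarrow> x * exp (- q * x)" by simp
    qed auto
    then show "((\<lambda>y. (\<phi> y - \<phi> q) / (y - q)) \<circ> y) \<longlonglongrightarrow> \<kappa> + (\<integral>x. x * exp (- q * x) \<partial>\<mu>)"
      unfolding comp_def eq by (intro tendsto_add tendsto_const)
  qed
  moreover have "at q within ?U = at q" by (rule at_within_open) (use q in auto)
  ultimately show ?thesis unfolding has_field_derivative_iff by simp
qed

lemma ennreal_deriv_exponent:
  assumes "0 < q"
  shows "ennreal (deriv \<phi> q) = ennreal \<kappa> + (\<integral>\<^sup>+x. ennreal (x * exp (- q * x)) \<partial>\<mu>)"
proof -
  have nonneg: "AE x in \<mu>. 0 \<le> x * exp (- q * x)" by (rule AE_I2) (simp add: space_levy)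
  show ?thesis
    unfolding DERIV_imp_deriv[OF exponent_has_derivative[OF assms]]
    using nn_integral_eq_integral[OF integrable_mult_exp[OF assms] nonneg] integral_nonneg_AE[OF nonneg] drift_nonneg
    by simp
qed

lemma ennreal_exponent_quotient:
  assumes "0 < q"
  shows "ennreal (\<phi> q / q) = ennreal \<kappa> + (\<integral>\<^sup>+x. ennreal ((1 - exp (- q * x)) / q) \<partial>\<mu>)"
proof -
  have int: "integrable \<mu> (\<lambda>x. (1 - exp (- q * x)) / q)"
    using integrable_one_minus_exp[OF assms] by simp
  have nonneg: "AE x in \<mu>. 0 \<le> (1 - exp (- q * x)) / q" by (rule AE_I2) (use assms in \<open>simp add: space_levy\<close>)
  have "\<phi> q / q = \<kappa> + (\<integral>x. (1 - exp (- q * x)) / q \<partial>\<mu>)"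
    unfolding exponent_eq[OF assms] using assms by (simp add: add_divide_distrib)
  then show ?thesis
    using nn_integral_eq_integral[OF int nonneg] integral_nonneg_AE[OF nonneg] drift_nonneg by simp
qed

text \<open>Monotone convergence along \<open>q = 1 / (n + 1)\<close>; as \<open>\<phi>'\<close> is monotone, the limit along this sequence is the
  limit from the right.\<close>

lemma deriv_zero_eq_mean: "deriv_zero \<phi> = mean"
proof -
  define \<psi> where "\<psi> q = (\<integral>\<^sup>+x. ennreal (x * exp (- q * x)) \<partial>\<mu>)" for q :: real
  have anti: "\<psi> q \<le> \<psi> p" if "p \<le> q" for p q
    unfolding \<psi>_def
  proof (rule nn_integral_mono)
    fix x assume "x \<in> space \<mu>"
    then have "0 < x" by (simp add: space_levy)
    with that show "ennreal (x * exp (- q * x)) \<le> ennreal (x * exp (- p * x))"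
      by (intro ennreal_leI mult_left_mono) auto
  qed
  have "(\<lambda>n. \<psi> (1 / Suc n)) \<longlonglongrightarrow> (\<integral>\<^sup>+x. ennreal x \<partial>\<mu>)"
    unfolding \<psi>_def
  proof (rule nn_integral_tendsto_mono_AE)
    show "AE x in \<mu>. mono (\<lambda>n. ennreal (x * exp (- (1 / Suc n) * x)))"
    proof (rule AE_I2)
      fix x assume "x \<in> space \<mu>"
      then have x: "0 < x" by (simp add: space_levy)
      show "mono (\<lambda>n. ennreal (x * exp (- (1 / Suc n) * x)))"
      proof (rule monoI)
        fix m n :: nat assume "m \<le> n"
        then have "1 / real (Suc n) \<le> 1 / real (Suc m)" by (simp add: frac_le)
        then show "ennreal (x * exp (- (1 / Suc m) * x)) \<le> ennreal (x * exp (- (1 / Suc n) * x))"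
          using x mult_right_mono[of "1 / real (Suc n)" "1 / real (Suc m)" x]
          by (intro ennreal_leI mult_left_mono) auto
      qed
    qed
    show "AE x in \<mu>. (\<lambda>n. ennreal (x * exp (- (1 / Suc n) * x))) \<longlonglongrightarrow> ennreal x"
    proof (rule AE_I2)
      fix x :: real
      have "(\<lambda>n. x * exp (- (1 / Suc n) * x)) \<longlonglongrightarrow> x * exp (- 0 * x)"
        by (intro tendsto_intros LIMSEQ_Suc lim_1_over_n)
      then show "(\<lambda>n. ennreal (x * exp (- (1 / Suc n) * x))) \<longlonglongrightarrow> ennreal x" by (intro tendsto_ennrealI) simp
    qed
  qed auto
  then have psi_lim: "(\<psi> \<longlongrightarrow> (\<integral>\<^sup>+x. ennreal x \<partial>\<mu>)) (at_right 0)" (is "(_ \<longlongrightarrow> ?L) _")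
  proof (intro order_tendstoI)
    fix a assume "a < ?L" and lim: "(\<lambda>n. \<psi> (1 / Suc n)) \<longlonglongrightarrow> ?L"
    then have "eventually (\<lambda>n. a < \<psi> (1 / Suc n)) sequentially" by (auto dest: order_tendstoD)
    then obtain n where n: "a < \<psi> (1 / Suc n)" by (auto simp: eventually_sequentially)
    have "eventually (\<lambda>q. q < 1 / real (Suc n)) (at_right 0)"
      by (rule eventually_at_rightI[of 0 "1 / real (Suc n)"]) auto
    then show "eventually (\<lambda>q. a < \<psi> q) (at_right 0)"
      by eventually_elim (use n anti in \<open>auto intro: less_le_trans less_imp_le\<close>)
  next
    fix a assume a: "?L < a"
    have "\<psi> q \<le> ?L" if "0 < q" for q
      unfolding \<psi>_def by (rule nn_integral_mono) (use that in \<open>auto simp: space_levy intro!: ennreal_leI mult_right_le_one_le\<close>)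
    then show "eventually (\<lambda>q. \<psi> q < a) (at_right 0)"
      using a eventually_at_right_less[of "0::real"] by (auto elim!: eventually_mono intro: le_less_trans)
  qed
  have "((\<lambda>q. ennreal \<kappa> + \<psi> q) \<longlongrightarrow> mean) (at_right 0)"
    unfolding mean_def by (intro tendsto_intros psi_lim)
  moreover have "eventually (\<lambda>q. ennreal \<kappa> + \<psi> q = ennreal (deriv \<phi> q)) (at_right 0)"
    using eventually_at_right_less[of "0::real"]
    by eventually_elim (simp add: ennreal_deriv_exponent \<psi>_def)
  ultimately have "((\<lambda>q. ennreal (deriv \<phi> q)) \<longlongrightarrow> mean) (at_right 0)"
    by (rule Lim_transform_eventually)
  then show ?thesis unfolding deriv_zero_def by (intro tendsto_Lim) auto
qed

lemma incseq_exponent_quotient: "incseq (\<lambda>n. ennreal (\<phi> (1 / Suc n) / (1 / Suc n)))"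
proof (rule incseq_SucI)
  fix n :: nat
  have "1 / real (Suc (Suc n)) \<le> 1 / real (Suc n)" by (simp add: frac_le)
  then have "(\<integral>\<^sup>+x. ennreal ((1 - exp (- (1 / Suc n) * x)) / (1 / Suc n)) \<partial>\<mu>)
    \<le> (\<integral>\<^sup>+x. ennreal ((1 - exp (- (1 / Suc (Suc n)) * x)) / (1 / Suc (Suc n))) \<partial>\<mu>)"
    by (intro nn_integral_mono ennreal_leI one_minus_exp_quotient_antimono) (auto simp: space_levy)
  then show "ennreal (\<phi> (1 / Suc n) / (1 / Suc n)) \<le> ennreal (\<phi> (1 / Suc (Suc n)) / (1 / Suc (Suc n)))"
    by (subst (1 2) ennreal_exponent_quotient) (auto intro: add_left_mono)
qed

lemma SUP_exponent_quotient: "(SUP n. ennreal (\<phi> (1 / Suc n) / (1 / Suc n))) = mean"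
proof -
  have "(\<lambda>n. \<integral>\<^sup>+x. ennreal ((1 - exp (- (1 / Suc n) * x)) / (1 / Suc n)) \<partial>\<mu>) \<longlonglongrightarrow> (\<integral>\<^sup>+x. ennreal x \<partial>\<mu>)"
  proof (rule nn_integral_tendsto_mono_AE)
    show "AE x in \<mu>. mono (\<lambda>n. ennreal ((1 - exp (- (1 / Suc n) * x)) / (1 / Suc n)))"
    proof (rule AE_I2)
      fix x assume "x \<in> space \<mu>"
      then show "mono (\<lambda>n. ennreal ((1 - exp (- (1 / Suc n) * x)) / (1 / Suc n)))"
        by (intro monoI ennreal_leI one_minus_exp_quotient_antimono) (auto simp: space_levy frac_le)
    qed
    show "AE x in \<mu>. (\<lambda>n. ennreal ((1 - exp (- (1 / Suc n) * x)) / (1 / Suc n))) \<longlonglongrightarrow> ennreal x"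
    proof (rule AE_I2)
      fix x :: real
      have "((\<lambda>u. - exp (- u * x)) has_real_derivative x * exp (- 0 * x)) (at 0)"
        by (auto intro!: derivative_eq_intros)
      then have "((\<lambda>u. (- exp (- u * x) - - exp (- 0 * x)) / (u - 0)) \<longlongrightarrow> x * exp (- 0 * x)) (at 0)"
        unfolding has_field_derivative_iff .
      then have "((\<lambda>u. (1 - exp (- u * x)) / u) \<longlongrightarrow> x) (at 0)" by simp
      moreover have "filterlim (\<lambda>n. 1 / real (Suc n)) (at 0) sequentially" by real_asymp
      ultimately have "(\<lambda>n. (1 - exp (- (1 / Suc n) * x)) / (1 / Suc n)) \<longlonglongrightarrow> x" by (rule filterlim_compose)
      then show "(\<lambda>n. ennreal ((1 - exp (- (1 / Suc n) * x)) / (1 / Suc n))) \<longlonglongrightarrow> ennreal x"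
        by (rule tendsto_ennrealI)
    qed
  qed auto
  then have "(\<lambda>n. ennreal \<kappa> + (\<integral>\<^sup>+x. ennreal ((1 - exp (- (1 / Suc n) * x)) / (1 / Suc n)) \<partial>\<mu>)) \<longlonglongrightarrow> mean"
    unfolding mean_def by (intro tendsto_intros)
  then have "(\<lambda>n. ennreal (\<phi> (1 / Suc n) / (1 / Suc n))) \<longlonglongrightarrow> mean"
    by (subst ennreal_exponent_quotient) auto
  with LIMSEQ_SUP[OF incseq_exponent_quotient] show ?thesis by (rule LIMSEQ_unique)
qed

lemma exponent_mono:
  assumes "0 < p" "p \<le> q" shows "\<phi> p \<le> \<phi> q"
proof -
  have "0 < q" using assms by simp
  have "(\<integral>x. (1 - exp (- p * x)) \<partial>\<mu>) \<le> (\<integral>x. (1 - exp (- q * x)) \<partial>\<mu>)"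
    using assms by (intro integral_mono integrable_one_minus_exp) (auto simp: space_levy)
  then show ?thesis
    unfolding exponent_eq[OF assms(1)] exponent_eq[OF \<open>0 < q\<close>]
    using mult_left_mono[OF assms(2) drift_nonneg] by simp
qed

text \<open>By monotone convergence \<open>\<phi> q\<close> tends to at least the total mass of \<open>\<mu>\<close>; this is where the mass is required to
  be infinite.\<close>

lemma exponent_unbounded: "\<exists>q>0. B \<le> \<phi> q"
proof (rule ccontr)
  assume "\<not> ?thesis"
  then have less: "\<phi> q < B" if "0 < q" for q using that by force
  have le: "(\<integral>\<^sup>+x. ennreal (1 - exp (- real (Suc n) * x)) \<partial>\<mu>) \<le> ennreal B" for n
  proof -
    have "(\<integral>\<^sup>+x. ennreal (1 - exp (- real (Suc n) * x)) \<partial>\<mu>) = ennreal (\<integral>x. 1 - exp (- real (Suc n) * x) \<partial>\<mu>)"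
      by (intro nn_integral_eq_integral integrable_one_minus_exp AE_I2) (auto simp: space_levy mult_le_0_iff)
    also have "\<dots> \<le> ennreal B"
      using less[of "real (Suc n)"] exponent_eq[of "real (Suc n)"] mult_nonneg_nonneg[OF drift_nonneg, of "real (Suc n)"]
      by (intro ennreal_leI) simp
    finally show ?thesis .
  qed
  have "(\<lambda>n. \<integral>\<^sup>+x. ennreal (1 - exp (- real (Suc n) * x)) \<partial>\<mu>) \<longlonglongrightarrow> (\<integral>\<^sup>+x. 1 \<partial>\<mu>)"
  proof (rule nn_integral_tendsto_mono_AE)
    show "AE x in \<mu>. mono (\<lambda>n. ennreal (1 - exp (- real (Suc n) * x)))"
      by (rule AE_I2) (auto simp: space_levy mono_def intro!: ennreal_leI mult_right_mono)
    show "AE x in \<mu>. (\<lambda>n. ennreal (1 - exp (- real (Suc n) * x))) \<longlonglongrightarrow> 1"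
    proof (rule AE_I2)
      fix x assume "x \<in> space \<mu>"
      then have "0 < x" by (simp add: space_levy)
      then have "(\<lambda>n. 1 - exp (- real (Suc n) * x)) \<longlonglongrightarrow> 1" by real_asymp
      from tendsto_ennrealI[OF this] show "(\<lambda>n. ennreal (1 - exp (- real (Suc n) * x))) \<longlonglongrightarrow> 1" by simp
    qed
  qed auto
  then have "(\<integral>\<^sup>+x. 1 \<partial>\<mu>) \<le> ennreal B" by (rule LIMSEQ_le_const2) (use le in auto)
  then show False using infinite by (simp add: space_levy top_unique)
qed

text \<open>\<open>\<phi>\<close> is positive somewhere as it is unbounded, and \<open>\<phi> q / q\<close> decreases.\<close>

lemma exponent_pos:
  assumes "0 < q" shows "0 < \<phi> q"
proof -
  obtain r where r: "0 < r" "1 \<le> \<phi> r" using exponent_unbounded by blast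
  show ?thesis
  proof (cases "q \<le> r")
    case True
    have "(\<integral>x. (1 - exp (- r * x)) / r \<partial>\<mu>) \<le> (\<integral>x. (1 - exp (- q * x)) / q \<partial>\<mu>)"
      using integrable_one_minus_exp[OF r(1)] integrable_one_minus_exp[OF assms] True assms
      by (intro integral_mono integrable_divide one_minus_exp_quotient_antimono) (auto simp: space_levy)
    then have "\<phi> r / r \<le> \<phi> q / q"
      unfolding exponent_eq[OF r(1)] exponent_eq[OF assms] using r assms by (simp add: add_divide_distrib)
    moreover have "0 < \<phi> r / r" using r by simp
    ultimately have "0 < \<phi> q / q" by linarith
    then show ?thesis using assms by (simp add: zero_less_divide_iff)
  next
    case False
    with exponent_mono[of r q] r show ?thesis by simp
  qed
qed

lemma exponent_tendsto_0: "(\<lambda>n. \<phi> (1 / Suc n)) \<longlonglongrightarrow> 0"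
proof -
  have "(\<lambda>n. \<integral>x. (1 - exp (- (1 / Suc n) * x)) \<partial>\<mu>) \<longlonglongrightarrow> (\<integral>x. 0 \<partial>\<mu>)"
  proof (rule integral_dominated_convergence[where w = "\<lambda>x. 1 - exp (- 1 * x)"])
    show "integrable \<mu> (\<lambda>x. 1 - exp (- 1 * x))" by (rule integrable_one_minus_exp) simp
    show "AE x in \<mu>. norm (1 - exp (- (1 / Suc n) * x)) \<le> 1 - exp (- 1 * x)" for n
      by (rule AE_I2) (auto simp: space_levy divide_le_eq)
    show "AE x in \<mu>. (\<lambda>n. 1 - exp (- (1 / Suc n) * x)) \<longlonglongrightarrow> 0"
      by (rule AE_I2) real_asymp
  qed auto
  moreover have "(\<lambda>n. \<kappa> * (1 / Suc n)) \<longlonglongrightarrow> 0" by real_asymp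
  ultimately have "(\<lambda>n. \<kappa> * (1 / Suc n) + (\<integral>x. (1 - exp (- (1 / Suc n) * x)) \<partial>\<mu>)) \<longlonglongrightarrow> 0 + 0"
    by (intro tendsto_add) auto
  then show ?thesis by (subst exponent_eq) auto
qed

end

section \<open>Subordinator paths and their inverse\<close>

text \<open>The properties that almost every path of \<open>S\<close> has and from which everything needed of the inverse follows
  path by path.\<close>

definition regular_path :: "(real \<Rightarrow> 'w \<Rightarrow> real) \<Rightarrow> 'w \<Rightarrow> bool" where
  "regular_path S \<omega> \<longleftrightarrow> S 0 \<omega> = 0 \<and> (\<forall>s\<ge>0. ((\<lambda>s. S s \<omega>) \<longlongrightarrow> S s \<omega>) (at_right s)) \<and>
     (\<forall>s t. 0 \<le> s \<longrightarrow> s < t \<longrightarrow> S s \<omega> < S t \<omega>) \<and> (\<forall>c. \<exists>s>0. c < S s \<omega>)"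

text \<open>Countably many almost sure inequalities give strict monotonicity at rational times; right-continuity extends
  it to all times, with two rationals in between to keep the inequality strict.\<close>

lemma regular_pathI_rational:
  assumes zero: "S 0 \<omega> = 0" and rc: "\<And>s. 0 \<le> s \<Longrightarrow> ((\<lambda>s. S s \<omega>) \<longlongrightarrow> S s \<omega>) (at_right s)"
    and less: "\<And>a b. a \<in> \<rat> \<Longrightarrow> b \<in> \<rat> \<Longrightarrow> 0 \<le> a \<Longrightarrow> a < b \<Longrightarrow> S a \<omega> < S b \<omega>"
    and unbounded: "\<And>k::nat. \<exists>n::nat. real k < S (real n) \<omega>"
  shows "regular_path S \<omega>"
proof -
  have le: "S s \<omega> \<le> S b \<omega>" if sb: "0 \<le> s" "s < b" "b \<in> \<rat>" for s b
  proof (rule ccontr)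
    assume "\<not> S s \<omega> \<le> S b \<omega>"
    then have "eventually (\<lambda>u. S b \<omega> < S u \<omega>) (at_right s)" using order_tendstoD(1)[OF rc[OF that(1)]] by simp
    then obtain d where d: "s < d" "\<And>u. s < u \<Longrightarrow> u < d \<Longrightarrow> S b \<omega> < S u \<omega>"
      unfolding eventually_at_right_field by blast
    obtain r where "r \<in> \<rat>" "s < r" "r < min b d" using Rats_dense_in_real[of s "min b d"] sb d by auto
    then show False using d(2)[of r] less[of r b] that by auto
  qed
  have ge: "S b \<omega> \<le> S t \<omega>" if "0 \<le> b" "b < t" "b \<in> \<rat>" for b t
  proof (rule ccontr)
    assume "\<not> S b \<omega> \<le> S t \<omega>"
    then have "eventually (\<lambda>u. S u \<omega> < S b \<omega>) (at_right t)" using order_tendstoD(2)[OF rc[of t]] that by simp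
    then obtain d where d: "t < d" "\<And>u. t < u \<Longrightarrow> u < d \<Longrightarrow> S u \<omega> < S b \<omega>"
      unfolding eventually_at_right_field by blast
    obtain r where "r \<in> \<rat>" "t < r" "r < d" using Rats_dense_in_real[OF d(1)] by auto
    then show False using d(2)[of r] less[of b r] that by auto
  qed
  have "S s \<omega> < S t \<omega>" if st: "0 \<le> s" "s < t" for s t
  proof -
    obtain a where a: "a \<in> \<rat>" "s < a" "a < t" using Rats_dense_in_real[OF st(2)] by auto
    obtain b where b: "b \<in> \<rat>" "a < b" "b < t" using Rats_dense_in_real[OF a(3)] by auto
    show ?thesis using le[of s a] less[of a b] ge[of b t] a b st by auto
  qed
  moreover have "\<exists>s>0. c < S s \<omega>" for c
  proof -
    obtain k :: nat where k: "c < real k" using reals_Archimedean2 by blast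
    obtain n :: nat where n: "real k < S (real n) \<omega>" using unbounded by blast
    have "n \<noteq> 0" using n zero by (cases n) auto
    then show ?thesis using k n by (intro exI[of _ "real n"]) auto
  qed
  ultimately show ?thesis unfolding regular_path_def using zero rc by blast
qed

lemma
  assumes "regular_path S \<omega>"
  shows regular_path_zero: "S 0 \<omega> = 0"
    and regular_path_right_continuous: "0 \<le> s \<Longrightarrow> ((\<lambda>s. S s \<omega>) \<longlongrightarrow> S s \<omega>) (at_right s)"
    and regular_path_less: "0 \<le> s \<Longrightarrow> s < t \<Longrightarrow> S s \<omega> < S t \<omega>"
    and regular_path_unbounded: "\<exists>s>0. c < S s \<omega>"
  using assms unfolding regular_path_def by auto

text \<open>\<open>E\<close> and \<open>S\<close> form a Galois connection: from left to right by right-continuity of \<open>S\<close>, from right to left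
  by strict monotonicity.\<close>

lemma inverse_process_le_iff:
  assumes p: "regular_path S \<omega>" and s: "0 \<le> s"
  shows "inverse_process S t \<omega> \<le> ennreal s \<longleftrightarrow> t \<le> S s \<omega>"
proof
  assume t: "t \<le> S s \<omega>"
  show "inverse_process S t \<omega> \<le> ennreal s"
  proof (rule ennreal_le_epsilon)
    fix e :: real assume "0 < e"
    then have "t < S (s + e) \<omega>" using regular_path_less[OF p s, of "s + e"] t by simp
    then have "inverse_process S t \<omega> \<le> ennreal (s + e)"
      unfolding inverse_process_def using s \<open>0 < e\<close> by (intro INF_lower) auto
    then show "inverse_process S t \<omega> \<le> ennreal s + ennreal e" using s \<open>0 < e\<close> by simp
  qed
next
  assume le: "inverse_process S t \<omega> \<le> ennreal s"
  show "t \<le> S s \<omega>"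
  proof (rule ccontr)
    assume "\<not> t \<le> S s \<omega>"
    then have "eventually (\<lambda>u. S u \<omega> < t) (at_right s)"
      using order_tendstoD(2)[OF regular_path_right_continuous[OF p s]] by simp
    then obtain d where d: "s < d" "\<And>u. s < u \<Longrightarrow> u < d \<Longrightarrow> S u \<omega> < t"
      unfolding eventually_at_right_field by blast
    have "ennreal ((s + d) / 2) \<le> inverse_process S t \<omega>"
      unfolding inverse_process_def
    proof (intro INF_greatest ennreal_leI)
      fix u assume u: "u \<in> {u. 0 < u \<and> t < S u \<omega>}"
      show "(s + d) / 2 \<le> u"
      proof (rule ccontr)
        assume "\<not> (s + d) / 2 \<le> u"
        then have "S u \<omega> < S ((s + d) / 2) \<omega>" using u by (intro regular_path_less[OF p]) auto
        moreover have "S ((s + d) / 2) \<omega> < t" using d by (intro d(2)) auto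
        ultimately show False using u by simp
      qed
    qed
    with le have "ennreal ((s + d) / 2) \<le> ennreal s" by (rule order_trans[rotated])
    then show False using s d(1) by (simp add: ennreal_le_iff)
  qed
qed

lemma inverse_process_finite:
  assumes p: "regular_path S \<omega>"
  shows "inverse_process S t \<omega> < \<infinity>"
proof -
  obtain s where "0 < s" "t < S s \<omega>" using regular_path_unbounded[OF p] by blast
  then have "inverse_process S t \<omega> \<le> ennreal s" using inverse_process_le_iff[OF p] by simp
  also have "\<dots> < \<infinity>" by simp
  finally show ?thesis .
qed

definition real_inverse :: "(real \<Rightarrow> 'w \<Rightarrow> real) \<Rightarrow> real \<Rightarrow> 'w \<Rightarrow> real" where
  "real_inverse S t \<omega> = enn2real (inverse_process S t \<omega>)"

lemma real_inverse_nonneg: "0 \<le> real_inverse S t \<omega>"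
  by (simp add: real_inverse_def)

lemma real_inverse_le_iff:
  assumes "regular_path S \<omega>" "0 \<le> s"
  shows "real_inverse S t \<omega> \<le> s \<longleftrightarrow> t \<le> S s \<omega>"
proof -
  have "inverse_process S t \<omega> = ennreal (real_inverse S t \<omega>)"
    using inverse_process_finite[OF assms(1), of t] by (simp add: real_inverse_def)
  then show ?thesis
    using inverse_process_le_iff[OF assms, of t] ennreal_le_iff[OF assms(2)] by simp
qed

text \<open>By the Galois connection the left side is the least \<open>u\<close> with \<open>S s \<omega> \<le> S u \<omega>\<close>. Thus \<open>E\<close> takes every value,
  which is what relates exits of the time-changed process to exits of \<open>X\<close>.\<close>

lemma real_inverse_at_path:
  assumes p: "regular_path S \<omega>" and s: "0 \<le> s"
  shows "real_inverse S (S s \<omega>) \<omega> = s"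
proof (rule antisym)
  show "real_inverse S (S s \<omega>) \<omega> \<le> s" by (simp add: real_inverse_le_iff[OF p s])
  show "s \<le> real_inverse S (S s \<omega>) \<omega>"
  proof (rule ccontr)
    assume "\<not> s \<le> real_inverse S (S s \<omega>) \<omega>"
    moreover have "S s \<omega> \<le> S (real_inverse S (S s \<omega>) \<omega>) \<omega>"
      by (rule real_inverse_le_iff[OF p real_inverse_nonneg, THEN iffD1, OF order_refl])
    ultimately show False
      using regular_path_less[OF p real_inverse_nonneg, of S "S s \<omega>" \<omega> s] by simp
  qed
qed

lemma real_inverse_pos:
  assumes p: "regular_path S \<omega>" and "0 < t"
  shows "0 < real_inverse S t \<omega>"
  using real_inverse_le_iff[OF p, of 0 t] regular_path_zero[OF p] assms(2) by simp

lemma real_inverse_mono: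
  assumes p: "regular_path S \<omega>" and "t \<le> u"
  shows "real_inverse S t \<omega> \<le> real_inverse S u \<omega>"
proof -
  have "u \<le> S (real_inverse S u \<omega>) \<omega>"
    by (rule real_inverse_le_iff[OF p real_inverse_nonneg, THEN iffD1, OF order_refl])
  then show ?thesis
    using assms(2) by (intro real_inverse_le_iff[OF p real_inverse_nonneg, THEN iffD2]) simp
qed

text \<open>Off the regular paths the infimum over all times in the definition of \<open>E\<close> need not be measurable. This
  version is jointly measurable everywhere and agrees with \<open>E\<close> on regular paths.\<close>

definition rational_inverse :: "(real \<Rightarrow> 'w \<Rightarrow> real) \<Rightarrow> real \<Rightarrow> 'w \<Rightarrow> real" where
  "rational_inverse S t \<omega> = enn2real (INF r\<in>{r\<in>\<rat>. 0 < r}. if t < S r \<omega> then ennreal r else \<infinity>)"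

lemma rational_inverse_eq:
  assumes p: "regular_path S \<omega>"
  shows "rational_inverse S t \<omega> = real_inverse S t \<omega>"
proof -
  have "(INF r\<in>{r\<in>\<rat>. 0 < r}. if t < S r \<omega> then ennreal r else \<infinity>) = inverse_process S t \<omega>"
  proof (rule antisym)
    show "inverse_process S t \<omega> \<le> (INF r\<in>{r\<in>\<rat>. 0 < r}. if t < S r \<omega> then ennreal r else \<infinity>)"
    proof (rule INF_greatest)
      fix r assume r: "r \<in> {r\<in>\<rat>. 0 < (r::real)}"
      show "inverse_process S t \<omega> \<le> (if t < S r \<omega> then ennreal r else \<infinity>)"
      proof (cases "t < S r \<omega>")
        case True
        then have "r \<in> {s. 0 < s \<and> t < S s \<omega>}" using r by simp
        from INF_lower[OF this, of ennreal] True show ?thesis by (simp only: inverse_process_def if_True)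
      qed simp
    qed
    show "(INF r\<in>{r\<in>\<rat>. 0 < r}. if t < S r \<omega> then ennreal r else \<infinity>) \<le> inverse_process S t \<omega>"
      unfolding inverse_process_def
    proof (rule INF_greatest, rule ennreal_le_epsilon)
      fix s e :: real assume s: "s \<in> {s. 0 < s \<and> t < S s \<omega>}" and e: "0 < e"
      obtain r where r: "r \<in> \<rat>" "s < r" "r < s + e" using Rats_dense_in_real[of s "s + e"] e by auto
      have "t < S r \<omega>" using s r regular_path_less[OF p, of s r] by simp
      with r s have "(INF r\<in>{r\<in>\<rat>. 0 < r}. if t < S r \<omega> then ennreal r else \<infinity>) \<le> ennreal r"
        by (intro INF_lower2[where i = r]) simp_all
      also have "ennreal r \<le> ennreal (s + e)" using r by (simp add: ennreal_leI)
      also have "\<dots> = ennreal s + ennreal e" using s e by simp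
      finally show "(INF r\<in>{r\<in>\<rat>. 0 < r}. if t < S r \<omega> then ennreal r else \<infinity>) \<le> ennreal s + ennreal e" .
    qed
  qed
  then show ?thesis by (simp add: rational_inverse_def real_inverse_def)
qed

lemma measurable_rational_inverse:
  assumes "\<And>u. 0 \<le> u \<Longrightarrow> S u \<in> borel_measurable M"
  shows "(\<lambda>(\<omega>, t). rational_inverse S t \<omega>) \<in> borel_measurable (M \<Otimes>\<^sub>M borel)"
  unfolding rational_inverse_def split_def
proof (rule borel_measurable_enn2real, rule borel_measurable_INF)
  show "countable {r \<in> \<rat>. 0 < (r::real)}" using countable_rat by (rule countable_subset[rotated]) auto
  fix r :: real assume "r \<in> {r \<in> \<rat>. 0 < r}"
  then have [measurable]: "S r \<in> borel_measurable M" using assms by auto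
  show "(\<lambda>x. if snd x < S r (fst x) then ennreal r else \<infinity>) \<in> borel_measurable (M \<Otimes>\<^sub>M borel)"
    by measurable
qed

lemma nn_integral_exp_tail:
  fixes b c :: real
  assumes "0 < c"
  shows "(\<integral>\<^sup>+t. indicator {b<..} t * ennreal (exp (- c * t)) \<partial>lborel) = ennreal (exp (- c * b) / c)"
proof -
  have "AE t in lborel. t \<noteq> b" by (rule AE_lborel_singleton)
  then have "(\<integral>\<^sup>+t. indicator {b<..} t * ennreal (exp (- c * t)) \<partial>lborel)
    = (\<integral>\<^sup>+t. ennreal (exp (- c * t)) * indicator {b..} t \<partial>lborel)"
    by (intro nn_integral_cong_AE, eventually_elim) (auto split: split_indicator)
  also have "\<dots> = ennreal (0 - (- exp (- c * b) / c))"
  proof (rule nn_integral_FTC_atLeast)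
    show "((\<lambda>t. - exp (- c * t) / c) \<longlongrightarrow> 0) at_top"
      using assms by real_asymp
    show "DERIV (\<lambda>t. - exp (- c * t) / c) t :> exp (- c * t)" for t
      using assms by (auto intro!: derivative_eq_intros)
  qed auto
  finally show ?thesis by simp
qed

locale infinite_subordinator = subordinator N S + infinite_levy_exponent \<phi> \<kappa> \<mu>
  for N :: "'w measure" and S and \<phi> :: "real \<Rightarrow> real" and \<kappa> :: real and \<mu> :: "real measure" +
  assumes laplace_exponent: "is_laplace_exponent N S \<phi>"
begin

lemma laplace:
  assumes "0 \<le> t" "0 < q"
  shows "integrable N (\<lambda>\<omega>. exp (- q * S t \<omega>))" "(\<integral>\<omega>. exp (- q * S t \<omega>) \<partial>N) = exp (- t * \<phi> q)"
proof -
  show *: "(\<integral>\<omega>. exp (- q * S t \<omega>) \<partial>N) = exp (- t * \<phi> q)"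
    using laplace_exponent assms unfolding is_laplace_exponent_def by blast
  show "integrable N (\<lambda>\<omega>. exp (- q * S t \<omega>))"
    using not_integrable_integral_eq[of N "\<lambda>\<omega>. exp (- q * S t \<omega>)"] * by fastforce
qed

lemma nn_laplace:
  assumes "0 \<le> t" "0 < q"
  shows "(\<integral>\<^sup>+\<omega>. ennreal (exp (- q * S t \<omega>)) \<partial>N) = ennreal (exp (- t * \<phi> q))"
  using nn_integral_eq_integral[OF laplace(1)[OF assms]] laplace(2)[OF assms] by simp

text \<open>Markov's inequality for \<open>exp (- q * S\<^sub>t)\<close>.\<close>

lemma prob_le_bound:
  assumes t: "0 \<le> t" and q: "0 < q"
  shows "emeasure N {\<omega>\<in>space N. S t \<omega> \<le> c} \<le> ennreal (exp (q * c - t * \<phi> q))"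
proof -
  note [measurable] = S_measurable[OF t]
  have "emeasure N {\<omega>\<in>space N. S t \<omega> \<le> c} = (\<integral>\<^sup>+\<omega>. indicator {\<omega>\<in>space N. S t \<omega> \<le> c} \<omega> \<partial>N)"
    by simp
  also have "\<dots> \<le> (\<integral>\<^sup>+\<omega>. ennreal (exp (q * c)) * ennreal (exp (- q * S t \<omega>)) \<partial>N)"
  proof (rule nn_integral_mono)
    fix \<omega>
    have "1 \<le> exp (q * c) * exp (- q * S t \<omega>)" if "S t \<omega> \<le> c"
      using that q by (simp flip: exp_add) 
    then show "indicator {\<omega>\<in>space N. S t \<omega> \<le> c} \<omega> \<le> ennreal (exp (q * c)) * ennreal (exp (- q * S t \<omega>))"
      by (auto split: split_indicator simp flip: ennreal_mult)
  qed
  also have "\<dots> = ennreal (exp (q * c)) * ennreal (exp (- t * \<phi> q))"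
    using nn_laplace[OF t q] by (subst nn_integral_cmult) auto
  also have "\<dots> = ennreal (exp (q * c - t * \<phi> q))" by (simp flip: ennreal_mult exp_add)
  finally show ?thesis .
qed

text \<open>The bound \<open>exp (- t * \<phi> q)\<close> on the probability of \<open>S\<^sub>t \<le> 0\<close> is arbitrarily small because \<open>\<phi>\<close> is unbounded.\<close>

lemma AE_positive:
  assumes t: "0 < t" shows "AE \<omega> in N. 0 < S t \<omega>"
proof -
  have [measurable]: "S t \<in> borel_measurable N" using S_measurable t by simp
  let ?p = "emeasure N {\<omega>\<in>space N. S t \<omega> \<le> 0}"
  have "?p \<le> ennreal e" if "0 < e" for e
  proof -
    obtain q where q: "0 < q" "- ln e / t \<le> \<phi> q" using exponent_unbounded by blast
    have "- (t * \<phi> q) \<le> ln e" using q(2) t by (simp add: field_simps)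
    then have "exp (- (t * \<phi> q)) \<le> e" using that by (metis exp_ln exp_le_cancel_iff)
    then show ?thesis
      using prob_le_bound[of t q 0] t q(1) by (auto intro: order_trans ennreal_leI)
  qed
  then have "?p = 0" using ennreal_le_epsilon[of 0 ?p] by simp
  then have "AE \<omega> in N. \<not> S t \<omega> \<le> 0" by (subst AE_iff_measurable[OF _ refl]) auto
  then show ?thesis by eventually_elim simp
qed

lemma AE_increasing:
  assumes "0 \<le> s" "s < t" shows "AE \<omega> in N. S s \<omega> < S t \<omega>"
proof -
  have [measurable]: "S s \<in> borel_measurable N" "S t \<in> borel_measurable N" "S (t - s) \<in> borel_measurable N"
    using S_measurable assms by simp_all
  have "AE x in distr N borel (S (t - s)). 0 < x"
    using AE_positive[of "t - s"] assms by (subst AE_distr_iff) auto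
  also have "distr N borel (S (t - s)) = distr N borel (\<lambda>\<omega>. S t \<omega> - S s \<omega>)"
    using stationary_increments[of s "t - s"] assms by simp
  finally show ?thesis by (subst (asm) AE_distr_iff) auto
qed

lemma AE_unbounded: "AE \<omega> in N. \<exists>n::nat. c < S (real n) \<omega>"
proof -
  have [measurable]: "S (real n) \<in> borel_measurable N" for n using S_measurable by simp
  let ?p = "emeasure N {\<omega>\<in>space N. \<forall>n::nat. S (real n) \<omega> \<le> c}"
  obtain q where q: "0 < q" "1 \<le> \<phi> q" using exponent_unbounded by blast
  have "?p \<le> ennreal (exp (q * c - real n))" for n
  proof -
    have "?p \<le> emeasure N {\<omega>\<in>space N. S (real n) \<omega> \<le> c}" by (rule emeasure_mono) auto
    also have "\<dots> \<le> ennreal (exp (q * c - real n * \<phi> q))" by (rule prob_le_bound) (use q in auto)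
    also have "\<dots> \<le> ennreal (exp (q * c - real n))"
      using mult_left_mono[OF q(2), of "real n"] by (intro ennreal_leI) simp
    finally show ?thesis .
  qed
  moreover have "(\<lambda>n. ennreal (exp (q * c - real n))) \<longlonglongrightarrow> ennreal 0"
    by (rule tendsto_ennrealI) real_asymp
  ultimately have "?p \<le> ennreal 0" by (intro LIMSEQ_le_const[where a = ?p]) auto
  then have "AE \<omega> in N. \<not> (\<forall>n::nat. S (real n) \<omega> \<le> c)" by (subst AE_iff_measurable[OF _ refl]) auto
  then show ?thesis by eventually_elim (simp add: not_le)
qed

lemma AE_regular_path: "AE \<omega> in N. regular_path S \<omega>"
proof -
  have "AE \<omega> in N. \<forall>a\<in>{a\<in>\<rat>. 0 \<le> a}. \<forall>b\<in>\<rat>. a < b \<longrightarrow> S a \<omega> < S b \<omega>"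
    using AE_increasing countable_rat
    by (intro AE_ball_countable[THEN iffD2] ballI) (auto intro: countable_subset[OF _ countable_rat])
  moreover have "AE \<omega> in N. \<forall>k::nat. \<exists>n::nat. real k < S (real n) \<omega>"
    using AE_unbounded by (simp add: AE_all_countable)
  ultimately show ?thesis
    using S_zero cadlag_paths
    by eventually_elim (auto intro!: regular_pathI_rational simp: cadlag_def)
qed

text \<open>Both sides integrate \<open>f\<close> against a finite measure on the line, so that it suffices to compare masses of
  the half-lines \<open>(a,\<infinity>)\<close>. On the left \<open>E\<^sub>t > a\<close> means \<open>t > S\<^sub>a\<close>, which leaves the Laplace transform of
  \<open>S\<^sub>a\<close>; on the right it is the tail of an exponential distribution.\<close>

lemma discounted_occupation:
  assumes q: "0 < q" and f [measurable]: "f \<in> borel_measurable borel"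
  shows "(\<integral>\<^sup>+z. indicator {0<..} (snd z) * ennreal (exp (- q * snd z)) * f (rational_inverse S (snd z) (fst z)) \<partial>(N \<Otimes>\<^sub>M lborel))
    = ennreal (\<phi> q / q) * (\<integral>\<^sup>+s. indicator {0<..} s * ennreal (exp (- \<phi> q * s)) * f s \<partial>lborel)"
proof -
  define w :: "'w \<times> real \<Rightarrow> ennreal" where "w z = indicator {0<..} (snd z) * ennreal (exp (- q * snd z))" for z
  define e where "e z = rational_inverse S (snd z) (fst z)" for z :: "'w \<times> real"
  define v :: "real \<Rightarrow> ennreal" where "v s = ennreal (\<phi> q / q) * (indicator {0<..} s * ennreal (exp (- \<phi> q * s)))" for s
  have w [measurable]: "w \<in> borel_measurable (N \<Otimes>\<^sub>M lborel)" unfolding w_def by measurable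
  have v [measurable]: "v \<in> borel_measurable lborel" unfolding v_def by measurable
  have e [measurable]: "e \<in> borel_measurable (N \<Otimes>\<^sub>M lborel)"
    using measurable_rational_inverse[of S N] S_measurable
    by (simp add: e_def[abs_def] split_def cong: measurable_cong_sets sets_pair_measure_cong)
  have "distr (density (N \<Otimes>\<^sub>M lborel) w) borel e = density lborel v" (is "?L = ?R")
  proof (rule measure_eqI_lessThan)
    fix a :: real
    \<comment> \<open>Both measures live on \<open>(0,\<infinity>)\<close>, so that a negative \<open>a\<close> may be replaced by \<open>0\<close>.\<close>
    define b where "b = max 0 a"
    have b: "0 \<le> b" by (simp add: b_def)
    have e_sets: "e -` {a<..} \<inter> space (N \<Otimes>\<^sub>M lborel) \<in> sets (N \<Otimes>\<^sub>M lborel)"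
      by (rule measurable_sets[OF e]) simp
    have "emeasure ?L {a<..} = emeasure (density (N \<Otimes>\<^sub>M lborel) w) (e -` {a<..} \<inter> space (N \<Otimes>\<^sub>M lborel))"
      by (subst emeasure_distr) (use e in \<open>auto simp: measurable_density_eq1\<close>)
    also have "\<dots> = (\<integral>\<^sup>+z. w z * indicator (e -` {a<..} \<inter> space (N \<Otimes>\<^sub>M lborel)) z \<partial>(N \<Otimes>\<^sub>M lborel))"
      by (rule emeasure_density[OF w e_sets])
    also have "\<dots> = (\<integral>\<^sup>+z. w z * indicator {a<..} (e z) \<partial>(N \<Otimes>\<^sub>M lborel))"
      by (rule nn_integral_cong) (simp split: split_indicator)
    also have "\<dots> = (\<integral>\<^sup>+\<omega>. \<integral>\<^sup>+t. w (\<omega>, t) * indicator {a<..} (e (\<omega>, t)) \<partial>lborel \<partial>N)"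
      by (rule lborel.nn_integral_fst[symmetric]) measurable
    also have "\<dots> = (\<integral>\<^sup>+\<omega>. ennreal (exp (- q * S b \<omega>)) * ennreal (1 / q) \<partial>N)"
    proof (rule nn_integral_cong_AE)
      show "AE \<omega> in N. (\<integral>\<^sup>+t. w (\<omega>, t) * indicator {a<..} (e (\<omega>, t)) \<partial>lborel) = ennreal (exp (- q * S b \<omega>)) * ennreal (1 / q)"
        using AE_regular_path
      proof eventually_elim
        case (elim \<omega>)
        have "(\<integral>\<^sup>+t. w (\<omega>, t) * indicator {a<..} (e (\<omega>, t)) \<partial>lborel)
          = (\<integral>\<^sup>+t. indicator {S b \<omega><..} t * ennreal (exp (- q * t)) \<partial>lborel)"
        proof (rule nn_integral_cong)
          fix t :: real
          have "0 \<le> S b \<omega>"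
            using regular_path_zero[OF elim] regular_path_less[OF elim, of 0 b] b by (cases "b = 0") auto
          moreover have "b < real_inverse S t \<omega> \<longleftrightarrow> S b \<omega> < t"
            using real_inverse_le_iff[OF elim b, of t] by (simp add: not_le[symmetric])
          moreover have "a < real_inverse S t \<omega> \<longleftrightarrow> b < real_inverse S t \<omega>" if "0 < t"
            using real_inverse_pos[OF elim that] by (auto simp: b_def)
          ultimately show "w (\<omega>, t) * indicator {a<..} (e (\<omega>, t)) = indicator {S b \<omega><..} t * ennreal (exp (- q * t))"
            by (auto simp: w_def e_def rational_inverse_eq[OF elim] split: split_indicator)
        qed
        also have "\<dots> = ennreal (exp (- q * S b \<omega>) * (1 / q))"
          using nn_integral_exp_tail[OF q] by simp
        finally show ?case using q by (simp add: ennreal_mult[symmetric])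
      qed
    qed
    also have "\<dots> = ennreal (exp (- b * \<phi> q)) * ennreal (1 / q)"
      using S_measurable[OF b] nn_laplace[OF b q] by (subst nn_integral_multc) auto
    finally have L: "emeasure ?L {a<..} = ennreal (exp (- b * \<phi> q)) * ennreal (1 / q)" .
    have "emeasure ?R {a<..} = (\<integral>\<^sup>+s. v s * indicator {a<..} s \<partial>lborel)"
      by (rule emeasure_density) auto
    also have "\<dots> = (\<integral>\<^sup>+s. ennreal (\<phi> q / q) * (indicator {b<..} s * ennreal (exp (- \<phi> q * s))) \<partial>lborel)"
      by (rule nn_integral_cong) (auto simp: v_def b_def split: split_indicator)
    also have "\<dots> = ennreal (\<phi> q / q) * ennreal (exp (- \<phi> q * b) / \<phi> q)"
      by (subst nn_integral_cmult) (use nn_integral_exp_tail[OF exponent_pos[OF q]] in auto)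
    also have "\<dots> = ennreal (exp (- b * \<phi> q)) * ennreal (1 / q)"
      using exponent_pos[OF q] q by (simp add: field_simps flip: ennreal_mult)
    finally show "emeasure ?L {a<..} = emeasure ?R {a<..}" using L by simp
    show "emeasure ?L {a<..} < \<infinity>" unfolding L by (simp add: ennreal_mult_less_top)
  qed auto
  then have "(\<integral>\<^sup>+s. f s \<partial>?L) = (\<integral>\<^sup>+s. f s \<partial>?R)" by simp
  also have "(\<integral>\<^sup>+s. f s \<partial>?L) = (\<integral>\<^sup>+z. w z * f (e z) \<partial>(N \<Otimes>\<^sub>M lborel))"
    by (subst nn_integral_distr, simp, simp, subst nn_integral_density) auto
  also have "(\<integral>\<^sup>+s. f s \<partial>?R) = (\<integral>\<^sup>+s. v s * f s \<partial>lborel)"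
    by (rule nn_integral_density) auto
  also have "\<dots> = ennreal (\<phi> q / q) * (\<integral>\<^sup>+s. indicator {0<..} s * ennreal (exp (- \<phi> q * s)) * f s \<partial>lborel)"
    unfolding v_def mult.assoc by (rule nn_integral_cmult) auto
  finally show ?thesis unfolding w_def e_def .
qed

text \<open>The discount rate \<open>q = 1 / (n + 1)\<close> tends to \<open>0\<close>. Everything is monotone in \<open>n\<close>, hence no finiteness is
  required and \<open>mean = \<infinity>\<close> is included.\<close>

theorem occupation_of_inverse:
  assumes f [measurable]: "f \<in> borel_measurable borel"
  shows "(\<integral>\<^sup>+z. indicator {0<..} (snd z) * f (rational_inverse S (snd z) (fst z)) \<partial>(N \<Otimes>\<^sub>M lborel))
    = mean * (\<integral>\<^sup>+s. indicator {0<..} s * f s \<partial>lborel)"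
proof -
  define q :: "nat \<Rightarrow> real" where "q n = 1 / Suc n" for n
  have q_pos: "0 < q n" for n by (simp add: q_def)
  have q_anti: "q n \<le> q m" if "m \<le> n" for m n using that by (simp add: q_def frac_le)
  have q_lim: "q \<longlonglongrightarrow> 0" unfolding q_def by real_asymp
  define r where "r n = ennreal (\<phi> (q n) / q n)" for n
  define J where "J n = (\<integral>\<^sup>+s. indicator {0<..} s * ennreal (exp (- \<phi> (q n) * s)) * f s \<partial>lborel)" for n
  have e [measurable]: "(\<lambda>z. rational_inverse S (snd z) (fst z)) \<in> borel_measurable (N \<Otimes>\<^sub>M lborel)"
    using measurable_rational_inverse[of S N] S_measurable
    by (simp add: split_def cong: measurable_cong_sets sets_pair_measure_cong)
  have weights: "mono (\<lambda>n. indicator {0<..} t * ennreal (exp (- c n * t)) * y)"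
      "(\<lambda>n. indicator {0<..} t * ennreal (exp (- c n * t)) * y) \<longlonglongrightarrow> indicator {0<..} t * y"
    if anti: "\<And>m n. m \<le> n \<Longrightarrow> c n \<le> c m" and lim: "c \<longlonglongrightarrow> 0" for c :: "nat \<Rightarrow> real" and t :: real and y :: ennreal
  proof -
    show "mono (\<lambda>n. indicator {0<..} t * ennreal (exp (- c n * t)) * y)"
      by (intro monoI) (auto split: split_indicator intro!: mult_right_mono ennreal_leI anti)
    have "(\<lambda>n. exp (- c n * t)) \<longlonglongrightarrow> exp (- 0 * t)" by (intro tendsto_intros lim)
    then have "(\<lambda>n. ennreal (exp (- c n * t))) \<longlonglongrightarrow> 1" using tendsto_ennrealI by fastforce
    then have "(\<lambda>n. ennreal (exp (- c n * t)) * y) \<longlonglongrightarrow> 1 * y" by (intro tendsto_mult_ennreal) auto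
    then show "(\<lambda>n. indicator {0<..} t * ennreal (exp (- c n * t)) * y) \<longlonglongrightarrow> indicator {0<..} t * y"
      by (auto split: split_indicator)
  qed
  have "(\<lambda>n. \<integral>\<^sup>+z. indicator {0<..} (snd z) * ennreal (exp (- q n * snd z)) * f (rational_inverse S (snd z) (fst z)) \<partial>(N \<Otimes>\<^sub>M lborel))
    \<longlonglongrightarrow> (\<integral>\<^sup>+z. indicator {0<..} (snd z) * f (rational_inverse S (snd z) (fst z)) \<partial>(N \<Otimes>\<^sub>M lborel))"
    by (intro nn_integral_tendsto_mono_AE AE_I2 weights q_anti q_lim) measurable
  then have lim: "(\<lambda>n. r n * J n)
    \<longlonglongrightarrow> (\<integral>\<^sup>+z. indicator {0<..} (snd z) * f (rational_inverse S (snd z) (fst z)) \<partial>(N \<Otimes>\<^sub>M lborel))"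
    using discounted_occupation[OF q_pos f] by (simp add: r_def J_def)
  have r: "incseq r" "(SUP n. r n) = mean"
    using incseq_exponent_quotient SUP_exponent_quotient by (simp_all add: r_def[abs_def] q_def)
  have "J \<longlonglongrightarrow> (\<integral>\<^sup>+s. indicator {0<..} s * f s \<partial>lborel)"
    unfolding J_def
    by (intro nn_integral_tendsto_mono_AE AE_I2 weights exponent_mono q_pos q_anti)
      (use exponent_tendsto_0 in \<open>auto simp: q_def[abs_def]\<close>)
  moreover have J: "incseq J"
  proof (rule incseq_SucI)
    show "J n \<le> J (Suc n)" for n
      unfolding J_def by (intro nn_integral_mono)
        (auto split: split_indicator intro!: mult_right_mono ennreal_leI exponent_mono q_pos q_anti)
  qed
  ultimately have J_SUP: "(SUP n. J n) = (\<integral>\<^sup>+s. indicator {0<..} s * f s \<partial>lborel)"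
    using LIMSEQ_SUP LIMSEQ_unique by blast
  have "incseq (\<lambda>n. r n * J n)"
    by (intro incseq_SucI mult_mono incseq_SucD[OF r(1)] incseq_SucD[OF J]) auto
  then have "(\<lambda>n. r n * J n) \<longlonglongrightarrow> (SUP n. r n * J n)" by (rule LIMSEQ_SUP)
  \<comment> \<open>Multiplication on \<open>[0,\<infinity>]\<close> is not continuous at \<open>(\<infinity>, 0)\<close>, but it commutes with
    suprema of increasing sequences.\<close>
  moreover have "(SUP n. r n * J n) = (SUP n. r n) * (SUP n. J n)"
  proof (rule antisym)
    show "(SUP n. r n * J n) \<le> (SUP n. r n) * (SUP n. J n)"
      by (intro SUP_least mult_mono SUP_upper) auto
    have "r m * J n \<le> (SUP n. r n * J n)" for m n
    proof -
      have "r m * J n \<le> r (max m n) * J (max m n)"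
        by (intro mult_mono incseqD[OF r(1)] incseqD[OF J]) auto
      also have "\<dots> \<le> (SUP n. r n * J n)" by (rule SUP_upper) simp
      finally show ?thesis .
    qed
    then show "(SUP n. r n) * (SUP n. J n) \<le> (SUP n. r n * J n)"
      by (simp add: SUP_mult_left_ennreal SUP_mult_right_ennreal SUP_le_iff)
  qed
  ultimately have "(\<lambda>n. r n * J n) \<longlonglongrightarrow> mean * (\<integral>\<^sup>+s. indicator {0<..} s * f s \<partial>lborel)"
    by (simp only: r(2) J_SUP)
  with lim show ?thesis by (rule LIMSEQ_unique)
qed

end

section \<open>Joint measurability of the process and measurability of exit times\<close>

lemma times_upto_infinity: "times_upto \<top> = {0..}"
  by (auto simp: times_upto_def)

lemma subalgebra_history:
  assumes "\<And>s. 0 \<le> s \<Longrightarrow> X s \<in> N \<rightarrow>\<^sub>M borel"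
  shows "subalgebra N (history N X t)"
proof -
  have "(\<lambda>\<omega>. \<lambda>s\<in>times_upto t. X s \<omega>) \<in> N \<rightarrow>\<^sub>M (\<Pi>\<^sub>M s\<in>times_upto t. borel)"
    by (rule measurable_restrict) (use assms in \<open>simp add: times_upto_def\<close>)
  then show ?thesis
    unfolding subalgebra_def history_def by (simp add: sets_image_in_sets)
qed

lemma measurable_history:
  assumes s: "0 \<le> s" shows "X s \<in> history N X \<infinity> \<rightarrow>\<^sub>M borel"
proof -
  let ?I = "times_upto \<infinity>"
  have "(\<lambda>\<omega>. \<lambda>s\<in>?I. X s \<omega>) \<in> history N X \<infinity> \<rightarrow>\<^sub>M (\<Pi>\<^sub>M s\<in>?I. borel)"
    unfolding history_def by (rule measurable_vimage_algebra1) (auto simp: space_PiM)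
  from measurable_compose[OF this measurable_component_singleton[of s]]
  show ?thesis using s by (simp add: times_upto_infinity)
qed

lemma sets_history_subset: "sets (history N X t) \<subseteq> sets (history N X \<infinity>)"
  using subalgebra_history[of X "history N X \<infinity>" t] measurable_history[of _ X N]
  by (simp add: subalgebra_def history_def)

context
  fixes N :: "'w measure" and X :: "real \<Rightarrow> 'w \<Rightarrow> 'a::topological_space"
  assumes X_measurable: "\<And>s. 0 \<le> s \<Longrightarrow> X s \<in> N \<rightarrow>\<^sub>M borel"
begin

lemma subalgebra_path_history: "subalgebra N (history N X t)"
  by (rule subalgebra_history) (rule X_measurable)

lemma space_completed_path_measure: "space (completed_path_measure N X) = space N"
  by (simp add: completed_path_measure_def space_restr_to_subalg)

text \<open>Sets of the completion are sets of the path history up to null sets; this transfers independence to the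
  completion.\<close>

lemma completed_path_setE:
  assumes "A \<in> sets (completed_path_measure N X)"
  obtains B Z where "B \<in> sets (history N X \<infinity>)" "Z \<in> null_sets N" "B \<subseteq> A" "A \<subseteq> B \<union> Z"
    "emeasure (completed_path_measure N X) A = emeasure N B"
proof -
  let ?R = "restr_to_subalg N (history N X \<infinity>)"
  note sub = subalgebra_path_history[of \<infinity>]
  from assms obtain B Z Z' where *: "A = B \<union> Z" "Z \<subseteq> Z'" "Z' \<in> null_sets ?R" "B \<in> sets ?R"
    unfolding completed_path_measure_def by (rule sets_completionE)
  have B: "B \<in> sets (history N X \<infinity>)" using *(4) sub by (simp add: sets_restr_to_subalg)
  have "Z' \<in> null_sets N" using *(3) sub by (rule null_sets_restr_to_subalg[THEN equalityD1, THEN subsetD, rotated, THEN IntD1])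
  moreover have "emeasure (completed_path_measure N X) A = emeasure N B"
  proof -
    have "Z \<in> null_sets (completion ?R)" by (rule completion.complete2[OF *(2) null_sets_completionI[OF *(3)]])
    then have "emeasure (completion ?R) (B \<union> Z) = emeasure (completion ?R) B"
      using *(4) by (intro emeasure_Un_null_set) auto
    also have "\<dots> = emeasure N B" using *(4) B sub by (simp add: emeasure_restr_to_subalg)
    finally show ?thesis by (simp add: * completed_path_measure_def)
  qed
  ultimately show thesis using that[OF B] * by blast
qed

lemma sets_completed_path_measure_subset: "sets (completed_path_measure N X) \<subseteq> sets (completion N)"
proof
  fix A assume "A \<in> sets (completed_path_measure N X)"
  then obtain B Z where "B \<in> sets (history N X \<infinity>)" "Z \<in> null_sets N" "B \<subseteq> A" "A \<subseteq> B \<union> Z"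
    by (rule completed_path_setE)
  then show "A \<in> sets (completion N)"
    using subalgebra_path_history[of \<infinity>]
    by (intro sets_completionI[of A B "A - B" Z]) (auto simp: subalgebra_def)
qed

lemma sets_augmented_filtration_subset:
  "sets (augmented_filtration N X t) \<subseteq> sets (completed_path_measure N X)"
proof -
  let ?F = "completed_path_measure N X"
  have "sets (history N X t) \<subseteq> sets ?F"
    unfolding completed_path_measure_def
    using sets_history_subset[of N X t] subalgebra_path_history[of \<infinity>]
    by (auto simp: sets_restr_to_subalg)
  then have gen: "sets (history N X t) \<union> null_sets ?F \<subseteq> sets ?F" by auto
  then have "sigma_sets (space ?F) (sets (history N X t) \<union> null_sets ?F) \<subseteq> sets ?F"
    by (rule sets.sigma_sets_subset)
  moreover have "sets (history N X t) \<union> null_sets ?F \<subseteq> Pow (space N)"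
    using gen sets.space_closed[of ?F] by (auto simp: space_completed_path_measure)
  ultimately show ?thesis
    unfolding augmented_filtration_def by (simp add: space_completed_path_measure)
qed

lemma space_augmented_filtration: "space (augmented_filtration N X t) = space N"
  unfolding augmented_filtration_def by (simp add: space_measure_of_conv)

context
  assumes progressive: "\<And>t. 0 \<le> t \<Longrightarrow> (\<lambda>(\<omega>, s). X s \<omega>) \<in>
    augmented_filtration N X (ennreal t) \<Otimes>\<^sub>M restrict_space borel {0..t} \<rightarrow>\<^sub>M borel"
begin

text \<open>Progressive measurability provides this on each \<open>[0, n]\<close>; the union over \<open>n\<close> takes place in the
  \<open>\<sigma>\<close>-algebra of the whole path.\<close>

lemma process_set_measurable:
  assumes A: "A \<in> sets borel"
  shows "{z \<in> space N \<times> {0<..}. X (snd z) (fst z) \<in> A} \<in> sets (completed_path_measure N X \<Otimes>\<^sub>M borel)"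
proof -
  let ?F = "completed_path_measure N X"
  have "{z \<in> space N \<times> {0..real n}. X (snd z) (fst z) \<in> A} \<in> sets (?F \<Otimes>\<^sub>M borel)" for n :: nat
  proof -
    let ?\<Omega> = "space N \<times> {0..real n}"
    let ?R = "restrict_space (?F \<Otimes>\<^sub>M borel) ?\<Omega>"
    have \<Omega>: "?\<Omega> \<in> sets (?F \<Otimes>\<^sub>M borel)"
      using sets.top[of ?F] by (intro pair_measureI) (auto simp: space_completed_path_measure)
    have "fst \<in> ?R \<rightarrow>\<^sub>M ?F" by (rule measurable_restrict_space1) simp
    then have 1: "fst \<in> ?R \<rightarrow>\<^sub>M augmented_filtration N X (ennreal (real n))"
      using sets_augmented_filtration_subset[of "ennreal (real n)"]
      by (auto simp: measurable_def space_augmented_filtration space_completed_path_measure)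
    have 2: "snd \<in> ?R \<rightarrow>\<^sub>M restrict_space borel {0..real n}"
      by (rule measurable_restrict_space2) (auto simp: space_restrict_space intro: measurable_restrict_space1)
    have "(\<lambda>z. X (snd z) (fst z)) \<in> ?R \<rightarrow>\<^sub>M borel"
      using measurable_compose[OF measurable_Pair[OF 1 2] progressive] by (simp add: split_def)
    from measurable_sets[OF this A] have "(\<lambda>z. X (snd z) (fst z)) -` A \<inter> space ?R \<in> sets (?F \<Otimes>\<^sub>M borel)"
      using \<Omega> by (subst (asm) sets_restrict_space_iff) auto
    also have "(\<lambda>z. X (snd z) (fst z)) -` A \<inter> space ?R = {z \<in> ?\<Omega>. X (snd z) (fst z) \<in> A}"
      using sets.sets_into_space[OF \<Omega>] by (auto simp: space_restrict_space)
    finally show ?thesis .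
  qed
  then have "(\<Union>n::nat. {z \<in> space N \<times> {0..real n}. X (snd z) (fst z) \<in> A}) \<inter> (space N \<times> {0<..}) \<in> sets (?F \<Otimes>\<^sub>M borel)"
    using sets.top[of ?F] by (intro sets.Int sets.countable_UN pair_measureI) (auto simp: space_completed_path_measure)
  also have "(\<Union>n::nat. {z \<in> space N \<times> {0..real n}. X (snd z) (fst z) \<in> A}) \<inter> (space N \<times> {0<..})
    = {z \<in> space N \<times> {0<..}. X (snd z) (fst z) \<in> A}"
    using real_arch_simple by fastforce
  finally show ?thesis .
qed

lemma process_jointly_measurable:
  "(\<lambda>z. X (snd z) (fst z)) \<in> restrict_space (completed_path_measure N X \<Otimes>\<^sub>M borel) (space N \<times> {0<..}) \<rightarrow>\<^sub>M borel"
proof (rule measurableI)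
  let ?F = "completed_path_measure N X" and ?\<Omega> = "space N \<times> {0::real<..}"
  have \<Omega>: "?\<Omega> \<in> sets (?F \<Otimes>\<^sub>M borel)"
    using sets.top[of ?F] by (intro pair_measureI) (auto simp: space_completed_path_measure)
  fix A :: "'a set" assume A: "A \<in> sets borel"
  have "(\<lambda>z. X (snd z) (fst z)) -` A \<inter> space (restrict_space (?F \<Otimes>\<^sub>M borel) ?\<Omega>) = {z \<in> ?\<Omega>. X (snd z) (fst z) \<in> A}"
    using sets.sets_into_space[OF \<Omega>] by (auto simp: space_restrict_space)
  then show "(\<lambda>z. X (snd z) (fst z)) -` A \<inter> space (restrict_space (?F \<Otimes>\<^sub>M borel) ?\<Omega>) \<in> sets (restrict_space (?F \<Otimes>\<^sub>M borel) ?\<Omega>)"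
    using process_set_measurable[OF A] \<Omega> by (auto simp: sets_restrict_space_iff)
qed simp

text \<open>The exit time is smaller than \<open>y\<close> if \<open>X\<close> is outside \<open>D\<close> at some time smaller than \<open>y\<close>: a projection
  of a jointly measurable set along the time axis.\<close>

lemma exit_time_measurable:
  assumes N: "prob_space N" and D: "D \<in> sets borel"
  shows "exit_time X D \<in> borel_measurable (completed_path_measure N X)"
proof (rule borel_measurableI_less)
  let ?F = "completed_path_measure N X"
  interpret F: complete_measure ?F
    unfolding completed_path_measure_def by (rule completion.complete_measure_axioms)
  fix y :: ennreal
  have fin: "emeasure ?F (space ?F) < \<infinity>"
  proof -
    interpret prob_space N by fact
    obtain B where "emeasure ?F (space ?F) = emeasure N B" using completed_path_setE[OF sets.top] by metis
    then show ?thesis using emeasure_finite[of B] by (simp add: less_top[symmetric])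
  qed
  let ?A = "{z \<in> space N \<times> {0<..}. X (snd z) (fst z) \<in> - D} \<inter> space ?F \<times> {s. ennreal s < y}"
  have "fst ` ?A \<in> sets ?F"
  proof (rule F.measurable_projection[OF fin])
    have "{s. ennreal s < y} \<in> sets borel" by measurable
    then show "?A \<in> sets (?F \<Otimes>\<^sub>M borel)"
      using D by (intro sets.Int process_set_measurable pair_measureI) auto
  qed
  also have "fst ` ?A = {\<omega> \<in> space ?F. exit_time X D \<omega> < y}"
    unfolding exit_time_def INF_less_iff by (force simp: space_completed_path_measure image_iff)
  finally show "{\<omega> \<in> space ?F. exit_time X D \<omega> < y} \<in> sets ?F" .
qed

end

end

text \<open>The identity concerns one starting point at a time, so that the law \<open>N = P x\<close> is kept fixed.\<close>

locale independent_time_change = infinite_subordinator N S \<phi> \<kappa> \<mu>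
  for N :: "'w measure" and S and \<phi> :: "real \<Rightarrow> real" and \<kappa> :: real and \<mu> :: "real measure" +
  fixes X :: "real \<Rightarrow> 'w \<Rightarrow> 'a::topological_space"
  assumes X_measurable: "\<And>s. 0 \<le> s \<Longrightarrow> X s \<in> N \<rightarrow>\<^sub>M borel"
    and progressive: "\<And>t. 0 \<le> t \<Longrightarrow> (\<lambda>(\<omega>, s). X s \<omega>) \<in>
      augmented_filtration N X (ennreal t) \<Otimes>\<^sub>M restrict_space borel {0..t} \<rightarrow>\<^sub>M borel"
    and independent: "indep_set (sets (history N X \<infinity>)) (sets (history N S \<infinity>))"
begin

text \<open>The two marginal laws: of the process, on a complete \<open>\<sigma>\<close>-algebra on which exit times are measurable, and of
  the subordinator.\<close>

definition F\<^sub>X :: "'w measure" where "F\<^sub>X = completed_path_measure N X"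
definition F\<^sub>S :: "'w measure" where "F\<^sub>S = restr_to_subalg N (history N S \<infinity>)"

lemma subalgebra_S: "subalgebra N (history N S \<infinity>)"
  by (rule subalgebra_history) (rule S_measurable)

lemma sets_F\<^sub>S: "sets F\<^sub>S = sets (history N S \<infinity>)"
  unfolding F\<^sub>S_def using subalgebra_S by (rule sets_restr_to_subalg)

lemma prob_space_F\<^sub>S: "prob_space F\<^sub>S"
  unfolding F\<^sub>S_def by (rule prob_space_restr_to_subalg[OF subalgebra_S]) unfold_locales

lemma space_F: "space F\<^sub>X = space N" "space F\<^sub>S = space N"
  using space_completed_path_measure[of X N] X_measurable
  by (simp_all add: F\<^sub>X_def F\<^sub>S_def space_restr_to_subalg)

lemma sets_F\<^sub>X_subset: "sets F\<^sub>X \<subseteq> sets (completion N)"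
  unfolding F\<^sub>X_def by (rule sets_completed_path_measure_subset) (rule X_measurable)

lemma F\<^sub>X_setE:
  assumes "A \<in> sets F\<^sub>X"
  obtains B Z where "B \<in> sets (history N X \<infinity>)" "Z \<in> null_sets N" "B \<subseteq> A" "A \<subseteq> B \<union> Z"
    "emeasure F\<^sub>X A = emeasure N B"
proof (rule completed_path_setE[of X N A])
  show "X s \<in> N \<rightarrow>\<^sub>M borel" if "0 \<le> s" for s using that by (rule X_measurable)
  show "A \<in> sets (completed_path_measure N X)" using assms unfolding F\<^sub>X_def .
qed (rule that, unfold F\<^sub>X_def)

lemma finite_measure_F\<^sub>X: "finite_measure F\<^sub>X"
proof (rule finite_measureI)
  obtain B where "emeasure F\<^sub>X (space F\<^sub>X) = emeasure N B"
    by (rule F\<^sub>X_setE[OF sets.top])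
  then show "emeasure F\<^sub>X (space F\<^sub>X) \<noteq> \<infinity>" by simp
qed

lemma measurable_diagonal: "(\<lambda>\<omega>. (\<omega>, \<omega>)) \<in> completion N \<rightarrow>\<^sub>M F\<^sub>X \<Otimes>\<^sub>M F\<^sub>S"
proof (rule measurable_Pair)
  show "(\<lambda>\<omega>. \<omega>) \<in> completion N \<rightarrow>\<^sub>M F\<^sub>X"
    using sets_F\<^sub>X_subset by (intro measurableI) (auto simp: space_F sets.Int_space_eq2)
  show "(\<lambda>\<omega>. \<omega>) \<in> completion N \<rightarrow>\<^sub>M F\<^sub>S"
    using subalgebra_S by (intro measurableI) (auto simp: space_F sets_F\<^sub>S subalgebra_def)
qed

text \<open>Independence of two \<open>\<sigma>\<close>-algebras says that the diagonal map sends \<open>N\<close> to the product of the restrictions.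
  The completion on the source is needed for the map to be measurable into \<open>F\<^sub>X\<close>.\<close>

lemma distr_diagonal: "F\<^sub>X \<Otimes>\<^sub>M F\<^sub>S = distr (completion N) (F\<^sub>X \<Otimes>\<^sub>M F\<^sub>S) (\<lambda>\<omega>. (\<omega>, \<omega>))"
proof (rule pair_measure_eqI)
  show "sigma_finite_measure F\<^sub>X"
    using finite_measure_F\<^sub>X by (rule finite_measure.axioms)
  show "sigma_finite_measure F\<^sub>S"
    using prob_space_F\<^sub>S by (intro finite_measure.axioms) (rule prob_space.finite_measure)
  fix A C assume A: "A \<in> sets F\<^sub>X" and C: "C \<in> sets F\<^sub>S"
  obtain B Z where B: "B \<in> sets (history N X \<infinity>)" and Z: "Z \<in> null_sets N" "B \<subseteq> A" "A \<subseteq> B \<union> Z"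
    and A_B: "emeasure F\<^sub>X A = emeasure N B"
    using A by (rule F\<^sub>X_setE)
  have B_N: "B \<in> sets N" using B subalgebra_path_history[of X N \<infinity>] X_measurable by (auto simp: subalgebra_def)
  have C': "C \<in> sets (history N S \<infinity>)" "C \<in> sets N"
    using C subalgebra_S by (auto simp: sets_F\<^sub>S subalgebra_def)
  have A_N: "A \<in> sets (completion N)"
    using sets_F\<^sub>X_subset A by auto
  have "emeasure (distr (completion N) (F\<^sub>X \<Otimes>\<^sub>M F\<^sub>S) (\<lambda>\<omega>. (\<omega>, \<omega>))) (A \<times> C) = emeasure (completion N) (A \<inter> C)"
    using A C sets.sets_into_space[OF A_N]
    by (subst emeasure_distr[OF measurable_diagonal]) (auto intro!: arg_cong[where f = "emeasure (completion N)"])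
  also have "\<dots> = emeasure (completion N) (B \<inter> C)"
  proof (rule emeasure_eq_AE)
    have "AE \<omega> in N. \<omega> \<notin> Z" using Z(1) by (rule AE_not_in)
    then have "AE \<omega> in completion N. \<omega> \<notin> Z" by (rule AE_completion)
    then show "AE \<omega> in completion N. (\<omega> \<in> A \<inter> C) = (\<omega> \<in> B \<inter> C)"
      by eventually_elim (use Z in auto)
  qed (use A_N B_N C' in auto)
  also have "\<dots> = emeasure N (B \<inter> C)" using B_N C' by simp
  also have "\<dots> = emeasure N B * emeasure N C"
    using indep_setD[OF independent B C'(1)] by (simp add: emeasure_eq_measure ennreal_mult)
  also have "\<dots> = emeasure F\<^sub>X A * emeasure F\<^sub>S C"
    using A_B emeasure_restr_to_subalg[OF subalgebra_S C'(1)] by (simp add: F\<^sub>S_def)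
  finally show "emeasure F\<^sub>X A * emeasure F\<^sub>S C = emeasure (distr (completion N) (F\<^sub>X \<Otimes>\<^sub>M F\<^sub>S) (\<lambda>\<omega>. (\<omega>, \<omega>))) (A \<times> C)"
    by simp
qed simp

lemma nn_integral_diagonal:
  assumes H: "H \<in> borel_measurable (F\<^sub>X \<Otimes>\<^sub>M F\<^sub>S)"
  shows "(\<integral>\<^sup>+\<omega>. H (\<omega>, \<omega>) \<partial>N) = (\<integral>\<^sup>+\<omega>. \<integral>\<^sup>+\<omega>'. H (\<omega>, \<omega>') \<partial>F\<^sub>S \<partial>F\<^sub>X)"
proof -
  interpret S: prob_space F\<^sub>S by (rule prob_space_F\<^sub>S)
  have "(\<integral>\<^sup>+\<omega>. H (\<omega>, \<omega>) \<partial>N) = (\<integral>\<^sup>+\<omega>. H (\<omega>, \<omega>) \<partial>completion N)" by (simp add: nn_integral_completion)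
  also have "\<dots> = (\<integral>\<^sup>+z. H z \<partial>distr (completion N) (F\<^sub>X \<Otimes>\<^sub>M F\<^sub>S) (\<lambda>\<omega>. (\<omega>, \<omega>)))"
    by (rule nn_integral_distr[OF measurable_diagonal, symmetric]) (use H in simp)
  also have "\<dots> = (\<integral>\<^sup>+z. H z \<partial>(F\<^sub>X \<Otimes>\<^sub>M F\<^sub>S))" by (simp only: distr_diagonal[symmetric])
  also have "\<dots> = (\<integral>\<^sup>+\<omega>. \<integral>\<^sup>+\<omega>'. H (\<omega>, \<omega>') \<partial>F\<^sub>S \<partial>F\<^sub>X)"
    by (rule S.nn_integral_fst[symmetric, OF H])
  finally show ?thesis .
qed

lemma measurable_path_inverse:
  "(\<lambda>z. rational_inverse S (snd z) (fst z)) \<in> borel_measurable (F\<^sub>S \<Otimes>\<^sub>M lborel)"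
proof -
  have "(\<lambda>(\<omega>, t). rational_inverse S t \<omega>) \<in> borel_measurable (F\<^sub>S \<Otimes>\<^sub>M borel)"
    by (rule measurable_rational_inverse)
      (unfold F\<^sub>S_def, rule measurable_in_subalg[OF subalgebra_S], rule measurable_history)
  then show ?thesis by (simp add: split_def cong: measurable_cong_sets sets_pair_measure_cong)
qed

lemma measurable_inverse_integral:
  assumes k: "k \<in> borel_measurable (F\<^sub>X \<Otimes>\<^sub>M borel)"
  shows "(\<lambda>z. \<integral>\<^sup>+t. indicator {0<..} t * k (fst z, rational_inverse S t (snd z)) \<partial>lborel)
    \<in> borel_measurable (F\<^sub>X \<Otimes>\<^sub>M F\<^sub>S)"
proof -
  have "(\<lambda>y. rational_inverse S (snd y) (snd (fst y))) \<in> borel_measurable ((F\<^sub>X \<Otimes>\<^sub>M F\<^sub>S) \<Otimes>\<^sub>M lborel)"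
    using measurable_compose[OF _ measurable_path_inverse, of "\<lambda>y. (snd (fst y), snd y)" "(F\<^sub>X \<Otimes>\<^sub>M F\<^sub>S) \<Otimes>\<^sub>M lborel"]
    by simp
  then have "(\<lambda>y. k (fst (fst y), rational_inverse S (snd y) (snd (fst y)))) \<in> borel_measurable ((F\<^sub>X \<Otimes>\<^sub>M F\<^sub>S) \<Otimes>\<^sub>M lborel)"
    by (intro measurable_compose[OF _ k] measurable_Pair) auto
  then have "(\<lambda>y. indicator {0<..} (snd y) * k (fst (fst y), rational_inverse S (snd y) (snd (fst y))))
    \<in> borel_measurable ((F\<^sub>X \<Otimes>\<^sub>M F\<^sub>S) \<Otimes>\<^sub>M lborel)"
    by (rule borel_measurable_times_ennreal[rotated]) measurable
  then show ?thesis
    by (intro lborel.borel_measurable_nn_integral) (simp add: split_def)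
qed

text \<open>For a frozen path of \<open>X\<close> the inner integral is the occupation formula of the inverse subordinator.\<close>

theorem time_changed_occupation:
  assumes k: "k \<in> borel_measurable (F\<^sub>X \<Otimes>\<^sub>M borel)"
  shows "(\<integral>\<^sup>+\<omega>. \<integral>\<^sup>+t. indicator {0<..} t * k (\<omega>, rational_inverse S t \<omega>) \<partial>lborel \<partial>N)
    = mean * (\<integral>\<^sup>+\<omega>. \<integral>\<^sup>+s. indicator {0<..} s * k (\<omega>, s) \<partial>lborel \<partial>N)"
proof -
  interpret S: prob_space F\<^sub>S by (rule prob_space_F\<^sub>S)
  define I where "I \<omega> = (\<integral>\<^sup>+s. indicator {0<..} s * k (\<omega>, s) \<partial>lborel)" for \<omega>
  have I: "I \<in> borel_measurable F\<^sub>X"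
    unfolding I_def using k by (intro lborel.borel_measurable_nn_integral) (simp add: split_def)
  have inner: "(\<integral>\<^sup>+\<omega>'. \<integral>\<^sup>+t. indicator {0<..} t * k (\<omega>, rational_inverse S t \<omega>') \<partial>lborel \<partial>F\<^sub>S) = mean * I \<omega>"
    if \<omega>: "\<omega> \<in> space F\<^sub>X" for \<omega>
  proof -
    have k\<omega>: "(\<lambda>s. k (\<omega>, s)) \<in> borel_measurable borel"
      using measurable_compose[OF measurable_Pair1'[OF \<omega>] k] by simp
    let ?h = "\<lambda>z. indicator {0<..} (snd z) * k (\<omega>, rational_inverse S (snd z) (fst z))"
    have h: "?h \<in> borel_measurable (F\<^sub>S \<Otimes>\<^sub>M lborel)"
      by (rule borel_measurable_times_ennreal[OF _ measurable_compose[OF measurable_path_inverse k\<omega>]]) measurable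
    have h_N: "?h \<in> borel_measurable (N \<Otimes>\<^sub>M lborel)"
    proof -
      have "(\<lambda>(\<omega>, t). rational_inverse S t \<omega>) \<in> borel_measurable (N \<Otimes>\<^sub>M borel)"
        by (rule measurable_rational_inverse) (rule S_measurable)
      then have "(\<lambda>z. rational_inverse S (snd z) (fst z)) \<in> borel_measurable (N \<Otimes>\<^sub>M lborel)"
        by (simp add: split_def cong: measurable_cong_sets sets_pair_measure_cong)
      from borel_measurable_times_ennreal[OF _ measurable_compose[OF this k\<omega>]] show ?thesis by measurable
    qed
    have "(\<lambda>\<omega>'. \<integral>\<^sup>+t. ?h (\<omega>', t) \<partial>lborel) \<in> borel_measurable F\<^sub>S"
      by (rule lborel.borel_measurable_nn_integral_fst[OF h])
    then have "(\<lambda>\<omega>'. \<integral>\<^sup>+t. ?h (\<omega>', t) \<partial>lborel) \<in> borel_measurable (history N S \<infinity>)"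
      using measurable_cong_sets[OF sets_F\<^sub>S refl] by blast
    then have "(\<integral>\<^sup>+\<omega>'. \<integral>\<^sup>+t. ?h (\<omega>', t) \<partial>lborel \<partial>F\<^sub>S) = (\<integral>\<^sup>+\<omega>'. \<integral>\<^sup>+t. ?h (\<omega>', t) \<partial>lborel \<partial>N)"
      unfolding F\<^sub>S_def by (rule nn_integral_subalgebra2[OF subalgebra_S])
    also have "\<dots> = (\<integral>\<^sup>+z. ?h z \<partial>(N \<Otimes>\<^sub>M lborel))" by (rule lborel.nn_integral_fst[OF h_N])
    also have "\<dots> = mean * I \<omega>" unfolding I_def by (rule occupation_of_inverse[OF k\<omega>])
    finally show ?thesis by simp
  qed
  have "(\<integral>\<^sup>+\<omega>. \<integral>\<^sup>+t. indicator {0<..} t * k (\<omega>, rational_inverse S t \<omega>) \<partial>lborel \<partial>N)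
    = (\<integral>\<^sup>+\<omega>. \<integral>\<^sup>+\<omega>'. \<integral>\<^sup>+t. indicator {0<..} t * k (\<omega>, rational_inverse S t \<omega>') \<partial>lborel \<partial>F\<^sub>S \<partial>F\<^sub>X)"
    using nn_integral_diagonal[OF measurable_inverse_integral[OF k]] by simp
  also have "\<dots> = (\<integral>\<^sup>+\<omega>. mean * I \<omega> \<partial>F\<^sub>X)" by (rule nn_integral_cong) (rule inner)
  also have "\<dots> = mean * (\<integral>\<^sup>+\<omega>. I \<omega> \<partial>F\<^sub>X)" by (rule nn_integral_cmult[OF I])
  also have "(\<integral>\<^sup>+\<omega>. I \<omega> \<partial>F\<^sub>X) = (\<integral>\<^sup>+\<omega>. I \<omega> \<partial>N)"
    using nn_integral_diagonal[of "\<lambda>z. I (fst z)"] I by (simp add: S.emeasure_space_1)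
  finally show ?thesis unfolding I_def .
qed

end

section \<open>Exit times and integrals of the time-changed process\<close>

lemma exit_time_less_iff: "exit_time Y D \<omega> < y \<longleftrightarrow> (\<exists>t>0. Y t \<omega> \<notin> D \<and> ennreal t < y)"
  unfolding exit_time_def INF_less_iff by auto

lemma exit_time_le: "0 < t \<Longrightarrow> Y t \<omega> \<notin> D \<Longrightarrow> exit_time Y D \<omega> \<le> ennreal t"
  unfolding exit_time_def by (rule INF_lower) simp

lemma before_exit_in: "0 < t \<Longrightarrow> ennreal t < exit_time Y D \<omega> \<Longrightarrow> Y t \<omega> \<in> D"
  using exit_time_le[of t Y \<omega> D] by (auto simp: not_le[symmetric])

lemma time_changed_eq: "time_changed X S t \<omega> = X (real_inverse S t \<omega>) \<omega>"
  by (simp add: time_changed_def real_inverse_def)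

text \<open>If \<open>X\<close> were outside \<open>D\<close> at some time \<open>s < E\<^sub>t\<close>, then the time-changed process would be outside \<open>D\<close> at
  time \<open>S\<^sub>s\<close>, which is smaller than \<open>t\<close>.\<close>

lemma before_time_changed_exit:
  assumes p: "regular_path S \<omega>" and t: "ennreal t < exit_time (time_changed X S) D \<omega>"
  shows "ennreal (real_inverse S t \<omega>) \<le> exit_time X D \<omega>"
proof (rule ccontr)
  assume "\<not> ?thesis"
  then obtain s where s: "0 < s" "X s \<omega> \<notin> D" "s < real_inverse S t \<omega>"
    by (auto simp: not_le exit_time_less_iff ennreal_less_iff)
  have "0 < S s \<omega>" using regular_path_less[OF p, of 0 s] regular_path_zero[OF p] s(1) by simp
  then have "exit_time (time_changed X S) D \<omega> \<le> ennreal (S s \<omega>)"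
    using s by (intro exit_time_le) (simp_all add: time_changed_eq real_inverse_at_path[OF p])
  also have "\<dots> \<le> ennreal t"
    using real_inverse_le_iff[OF p, of s t] s by (intro ennreal_leI) simp
  finally show False using t by simp
qed

lemma after_time_changed_exit:
  assumes p: "regular_path S \<omega>" and t: "exit_time (time_changed X S) D \<omega> < ennreal t"
  shows "exit_time X D \<omega> \<le> ennreal (real_inverse S t \<omega>)"
proof -
  obtain u where u: "0 < u" "X (real_inverse S u \<omega>) \<omega> \<notin> D" "ennreal u < ennreal t"
    using t by (auto simp: exit_time_less_iff time_changed_eq)
  then have "exit_time X D \<omega> \<le> ennreal (real_inverse S u \<omega>)"
    by (intro exit_time_le real_inverse_pos[OF p])
  also have "\<dots> \<le> ennreal (real_inverse S t \<omega>)"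
    using u by (intro ennreal_leI real_inverse_mono[OF p]) (simp add: ennreal_less_iff)
  finally show ?thesis .
qed

text \<open>The process \<open>f(X\<^sub>s)\<close>, set to \<open>0\<close> from the exit on.\<close>

definition killed :: "(real \<Rightarrow> 'w \<Rightarrow> 'a) \<Rightarrow> 'a set \<Rightarrow> ('a \<Rightarrow> ennreal) \<Rightarrow> 'w \<times> real \<Rightarrow> ennreal" where
  "killed X D f z = (if 0 < snd z \<and> ennreal (snd z) < exit_time X D (fst z) then f (X (snd z) (fst z)) else 0)"

lemma integral_until_exit_eq_killed:
  "integral_until_exit X D f \<omega> = (\<integral>\<^sup>+s. indicator {0<..} s * killed X D f (\<omega>, s) \<partial>lborel)"
  unfolding integral_until_exit_def
  by (rule nn_integral_cong) (simp add: killed_def split: split_indicator)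

text \<open>The two integrands agree except for \<open>t\<close> equal to the exit time of the time-changed process and for
  \<open>E\<^sub>t\<close> equal to the exit time of \<open>X\<close>.\<close>

lemma integral_until_exit_time_changed:
  assumes p: "regular_path S \<omega>"
    and null: "AE t in lborel. \<not> (0 < t \<and> ennreal (real_inverse S t \<omega>) = exit_time X D \<omega>)"
  shows "integral_until_exit (time_changed X S) D f \<omega>
    = (\<integral>\<^sup>+t. indicator {0<..} t * killed X D f (\<omega>, rational_inverse S t \<omega>) \<partial>lborel)"
  unfolding integral_until_exit_def
proof (rule nn_integral_cong_AE)
  let ?\<tau> = "exit_time (time_changed X S) D \<omega>"
  have "AE t in lborel. t \<noteq> enn2real ?\<tau>" by (rule AE_lborel_singleton)
  with null show "AE t in lborel. f (time_changed X S t \<omega>) * indicator {t. 0 < t \<and> ennreal t < ?\<tau>} t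
      = indicator {0<..} t * killed X D f (\<omega>, rational_inverse S t \<omega>)"
  proof eventually_elim
    case (elim t)
    have "ennreal t < ?\<tau> \<longleftrightarrow> ennreal (real_inverse S t \<omega>) < exit_time X D \<omega>" if "0 < t"
    proof
      assume "ennreal t < ?\<tau>"
      from before_time_changed_exit[OF p this] show "ennreal (real_inverse S t \<omega>) < exit_time X D \<omega>"
        using elim(1) that by (simp add: le_less)
    next
      assume less: "ennreal (real_inverse S t \<omega>) < exit_time X D \<omega>"
      have "?\<tau> \<noteq> ennreal t" using elim(2) that by auto
      moreover have "\<not> ?\<tau> < ennreal t" using after_time_changed_exit[OF p, of X D t] less by auto
      ultimately show "ennreal t < ?\<tau>" by simp
    qed
    then show ?case
      using real_inverse_pos[OF p, of t]
      by (simp add: killed_def rational_inverse_eq[OF p] time_changed_eq split: split_indicator)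
  qed
qed

context independent_time_change
begin

lemma process_in_measurable:
  assumes h: "h \<in> borel_measurable borel"
  shows "(\<lambda>z. h (X (snd z) (fst z)) * indicator (space N \<times> {0<..}) z) \<in> (borel_measurable (F\<^sub>X \<Otimes>\<^sub>M borel) :: ('w \<times> real \<Rightarrow> ennreal) set)"
proof -
  have "(\<lambda>z. X (snd z) (fst z)) \<in> restrict_space (F\<^sub>X \<Otimes>\<^sub>M borel) (space N \<times> {0<..}) \<rightarrow>\<^sub>M borel"
    unfolding F\<^sub>X_def by (rule process_jointly_measurable) (fact X_measurable, fact progressive)
  from measurable_compose[OF this h] show ?thesis
    using sets.top[of F\<^sub>X]
    by (subst (asm) borel_measurable_restrict_space_iff_ennreal)
      (auto intro!: sets.Int pair_measureI simp: space_F)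
qed

lemma exit_time_measurable_F\<^sub>X:
  assumes "D \<in> sets borel"
  shows "exit_time X D \<in> borel_measurable F\<^sub>X"
  unfolding F\<^sub>X_def
  by (rule exit_time_measurable[OF X_measurable progressive prob_space_axioms assms])

lemma killed_measurable:
  assumes D: "D \<in> sets borel" and f: "f \<in> borel_measurable (restrict_space borel D)"
  shows "killed X D f \<in> borel_measurable (F\<^sub>X \<Otimes>\<^sub>M borel)"
proof -
  note [measurable] = exit_time_measurable_F\<^sub>X[OF D]
  have "(\<lambda>y. f y * indicator D y) \<in> borel_measurable borel"
    using f D by (subst (asm) borel_measurable_restrict_space_iff_ennreal) auto
  note [measurable] = process_in_measurable[OF this]
  have "(\<lambda>z. if ennreal (snd z) < exit_time X D (fst z)
      then f (X (snd z) (fst z)) * indicator D (X (snd z) (fst z)) * indicator (space N \<times> {0<..}) z else 0)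
    \<in> borel_measurable (F\<^sub>X \<Otimes>\<^sub>M borel)" by measurable
  also have "?this \<longleftrightarrow> ?thesis"
  proof (rule measurable_cong)
    fix z assume "z \<in> space (F\<^sub>X \<Otimes>\<^sub>M (borel :: real measure))"
    then have "fst z \<in> space N" by (auto simp: space_pair_measure space_F)
    then show "(if ennreal (snd z) < exit_time X D (fst z)
      then f (X (snd z) (fst z)) * indicator D (X (snd z) (fst z)) * indicator (space N \<times> {0<..}) z else 0) = killed X D f z"
      using before_exit_in[of "snd z" X D "fst z"]
      by (auto simp: killed_def mem_Times_iff split: split_indicator)
  qed
  finally show ?thesis .
qed

text \<open>\<open>E\<close> is constant on an interval if \<open>S\<close> jumps. As the exit time of \<open>X\<close> is independent of \<open>S\<close>, it almost surely
  avoids the jump times: the occupation formula turns the expected duration of \<open>E\<^sub>t = \<tau>\<close> into the Lebesgue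
  measure of a single point.\<close>

lemma AE_exit_time_not_jumped:
  assumes D: "D \<in> sets borel"
  shows "AE \<omega> in N. AE t in lborel. \<not> (0 < t \<and> ennreal (real_inverse S t \<omega>) = exit_time X D \<omega>)"
proof -
  define k :: "'w \<times> real \<Rightarrow> ennreal"
    where "k z = (if 0 < snd z \<and> ennreal (snd z) = exit_time X D (fst z) then 1 else 0)" for z
  note [measurable] = exit_time_measurable_F\<^sub>X[OF D]
  have k: "k \<in> borel_measurable (F\<^sub>X \<Otimes>\<^sub>M borel)" unfolding k_def by measurable
  let ?I = "\<lambda>\<omega>. \<integral>\<^sup>+t. indicator {0<..} t * k (\<omega>, rational_inverse S t \<omega>) \<partial>lborel"
  have "(\<integral>\<^sup>+s. indicator {0<..} s * k (\<omega>, s) \<partial>lborel) = 0" for \<omega>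
  proof -
    have "AE s in lborel. s \<noteq> enn2real (exit_time X D \<omega>)" by (rule AE_lborel_singleton)
    then have "(\<integral>\<^sup>+s. indicator {0<..} s * k (\<omega>, s) \<partial>lborel) = (\<integral>\<^sup>+(s::real). 0 \<partial>lborel)"
      by (intro nn_integral_cong_AE, eventually_elim) (auto simp: k_def split: split_indicator, metis enn2real_ennreal less_imp_le)
    then show ?thesis by simp
  qed
  then have "(\<integral>\<^sup>+\<omega>. ?I \<omega> \<partial>completion N) = 0"
    using time_changed_occupation[OF k] by (simp add: nn_integral_completion)
  moreover have "?I \<in> borel_measurable (completion N)"
    using measurable_compose[OF measurable_diagonal measurable_inverse_integral[OF k]] by simp
  ultimately have "AE \<omega> in completion N. ?I \<omega> = 0" by (simp add: nn_integral_0_iff_AE)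
  then have "AE \<omega> in N. ?I \<omega> = 0" by (simp add: AE_completion_iff)
  then show ?thesis
    using AE_regular_path AE_space
  proof eventually_elim
    case (elim \<omega>)
    have "(\<lambda>(\<omega>, t). rational_inverse S t \<omega>) \<in> borel_measurable (N \<Otimes>\<^sub>M borel)"
      by (rule measurable_rational_inverse) (rule S_measurable)
    from measurable_compose[OF measurable_Pair1'[OF elim(3)] this]
    have e: "(\<lambda>t. rational_inverse S t \<omega>) \<in> borel_measurable borel" by simp
    have "(\<lambda>s. k (\<omega>, s)) \<in> borel_measurable borel"
      using measurable_compose[OF measurable_Pair1'[of \<omega> F\<^sub>X] k] elim(3) by (simp add: space_F)
    from measurable_compose[OF e this] have [measurable]: "(\<lambda>t. k (\<omega>, rational_inverse S t \<omega>)) \<in> borel_measurable borel" .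
    have "AE t in lborel. indicator {0<..} t * k (\<omega>, rational_inverse S t \<omega>) = 0"
      using elim(1) by (subst (asm) nn_integral_0_iff_AE) auto
    then show ?case
    proof eventually_elim
      case (elim t)
      then show ?case
        using \<open>regular_path S \<omega>\<close> real_inverse_pos[of S \<omega> t]
        by (auto simp: k_def rational_inverse_eq split: if_splits)
    qed
  qed
qed

theorem green_identity:
  assumes D: "D \<in> sets borel" and f: "f \<in> borel_measurable (restrict_space borel D)"
  shows "(\<integral>\<^sup>+\<omega>. integral_until_exit (time_changed X S) D f \<omega> \<partial>N)
    = deriv_zero \<phi> * (\<integral>\<^sup>+\<omega>. integral_until_exit X D f \<omega> \<partial>N)"
proof -
  have "(\<integral>\<^sup>+\<omega>. integral_until_exit (time_changed X S) D f \<omega> \<partial>N)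
    = (\<integral>\<^sup>+\<omega>. \<integral>\<^sup>+t. indicator {0<..} t * killed X D f (\<omega>, rational_inverse S t \<omega>) \<partial>lborel \<partial>N)"
    using AE_regular_path AE_exit_time_not_jumped[OF D]
    by (intro nn_integral_cong_AE, eventually_elim) (rule integral_until_exit_time_changed)
  also have "\<dots> = mean * (\<integral>\<^sup>+\<omega>. \<integral>\<^sup>+s. indicator {0<..} s * killed X D f (\<omega>, s) \<partial>lborel \<partial>N)"
    by (rule time_changed_occupation[OF killed_measurable[OF D f]])
  finally show ?thesis by (simp add: deriv_zero_eq_mean integral_until_exit_eq_killed)
qed

end

theorem theorem3p1:
  fixes X :: "real \<Rightarrow> 'w \<Rightarrow> 'a::topological_space"
    and P :: "'a \<Rightarrow> 'w measure"
    and S :: "real \<Rightarrow> 'w \<Rightarrow> real"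
    and \<phi> :: "real \<Rightarrow> real" and \<kappa> :: real and \<mu> :: "real measure"
    and D :: "'a set" and x :: 'a
  assumes markov: "strong_markov_process X P"
    and subordinator: "\<And>y. subordinator (P y) S"
    and independent: "\<And>y. prob_space.indep_set (P y)
          (sets (history (P y) X \<infinity>)) (sets (history (P y) S \<infinity>))"
    and exponent: "\<And>y. is_laplace_exponent (P y) S \<phi>"
    and levy_measure: "has_drift_levy_measure \<phi> \<kappa> \<mu>"
    and infinite: "emeasure \<mu> {0<..} = \<infinity>"
    and open_D: "open D"
    and x_in_D: "x \<in> D"
  shows "(\<forall>f \<in> borel_measurable (restrict_space borel D).
            (\<integral>\<^sup>+\<omega>. integral_until_exit (time_changed X S) D f \<omega> \<partial>P x)
              = deriv_zero \<phi> * (\<integral>\<^sup>+\<omega>. integral_until_exit X D f \<omega> \<partial>P x) \<and>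
            deriv_zero \<phi> * (\<integral>\<^sup>+\<omega>. integral_until_exit X D f \<omega> \<partial>P x)
              = deriv_zero \<phi> * green_operator X P D f x) \<and>
         (\<forall>A \<in> sets borel. A \<subseteq> D \<longrightarrow>
            occupation_measure (time_changed X S) P D x A
              = deriv_zero \<phi> * occupation_measure X P D x A)"
proof -
  interpret independent_time_change "P x" S \<phi> \<kappa> \<mu> X
  proof (intro independent_time_change.intro infinite_subordinator.intro subordinator
      infinite_levy_exponent.intro infinite_subordinator_axioms.intro independent_time_change_axioms.intro
      levy_measure infinite exponent independent)
    show "X s \<in> P x \<rightarrow>\<^sub>M borel" if "0 \<le> s" for s
      using strong_markov_process.X_measurable[OF markov that] .
    show "(\<lambda>(\<omega>, s). X s \<omega>) \<in> augmented_filtration (P x) X (ennreal t) \<Otimes>\<^sub>M restrict_space borel {0..t} \<rightarrow>\<^sub>M borel"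
      if "0 \<le> t" for t
      using strong_markov_process.progressively_measurable[OF markov that] .
  qed
  have D: "D \<in> sets borel" using open_D by simp
  have "(indicator A :: 'a \<Rightarrow> ennreal) \<in> borel_measurable (restrict_space borel D)" if "A \<in> sets borel" for A :: "'a set"
    using that by (intro measurable_restrict_space1 borel_measurable_indicator)
  then show ?thesis
    using green_identity[OF D] by (simp add: green_operator_def occupation_measure_def)
qed

end
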